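(* Let $k,l\ge 0$, let $\Gamma$ be an $l$-graph and let $X$ be a $\Gamma$-system of $k$-morphs. Then there exists a $\Gamma$-bundle $\Sigma$ for $X$. Moreover, $\Sigma$ is unique up to isomorphism: that is, if $\Psi$ is another $\Gamma$-bundle for $X$, then there is an isomorphism $\Sigma \cong \Psi$ of $(k+l)$-graphs which intertwines the bundle maps on $\Sigma$ and $\Psi$.
   Context: **$k$-graphs.** Let $k\ge 0$ ($\mathbb{N}^0=\{0\}$). A $k$-graph is a nonempty countable small category $\Lambda$ with a functor $d:\Lambda\to\mathbb{N}^k$ satisfying the factorisation property: whenever $d(\lambda)=m+n$ there are unique $\mu,\nu\in\Lambda$ with $d(\mu)=m$, $d(\nu)=n$ and $\lambda=\mu\nu$. Objects are identified with $\Lambda^0=d^{-1}(0)$; $\Lambda^n=d^{-1}(n)$; $r,s$ are the codomain and domain maps. Isomorphisms of $k$-graphs are degree-preserving isomorphisms of categories. For a homomorphism $\omega:\mathbb{N}^k\to\mathbb{N}^l$, an $\omega$-quasimorphism from a $k$-graph to an $l$-graph is a functor $f$ with $d(f(\lambda))=\omega(d(\lambda))$. **$k$-morphs.** A $\Lambda$--$\Gamma$ morph is a countable set $X$ with maps $r:X\to\Lambda^0$, $s:X\to\Gamma^0$ and a bijection $\phi: X*_{\Gamma^0}\Gamma\to\Lambda*_{\Lambda^0}X$, where $X*_{\Gamma^0}\Gamma=\{(x,\gamma): s(x)=r(\gamma)\}$ and $\Lambda*_{\Lambda^0}X=\{(\lambda,x): s(\lambda)=r(x)\}$, such that whenever $\phi(x_1,\gamma_1)=(\lambda_1,x_2)$: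 (1) $d(\gamma_1)=d(\lambda_1)$; (2) $s(\gamma_1)=s(x_2)$; (3) $r(\lambda_1)=r(x_1)$; and (4) if also $\phi(x_2,\gamma_2)=(\lambda_2,x_3)$, then $\phi(x_1,\gamma_1\gamma_2)=(\lambda_1\lambda_2,x_3)$. An isomorphism of $\Lambda$--$\Gamma$ morphs is a bijection $\theta:X\to Y$ intertwining $r$ and $s$ with $(\operatorname{id}_\Lambda\times\theta)\circ\phi_X=\phi_Y\circ(\theta\times\operatorname{id}_\Gamma)$. $I_\Lambda$ is the $\Lambda$--$\Lambda$ morph $\Lambda^0$ with $r=s=\operatorname{id}$ and $\phi(r(\lambda),\lambda)=(\lambda,s(\lambda))$. If $X_i$ is a $\Lambda_{i-1}$--$\Lambda_i$ morph ($i=1,2$), then $X_1*_{\Lambda_1^0}X_2=\{(x_1,x_2): s(x_1)=r(x_2)\}$ is a $\Lambda_0$--$\Lambda_2$ morph with $r(x_1,x_2)=r(x_1)$, $s(x_1,x_2)=s(x_2)$, $\phi((x_1,x_2),\lambda_2)=(\lambda_0,(x_1',x_2'))$ where $\phi_2(x_2,\lambda_2)=(\lambda_1,x_2')$ and $\phi_1(x_1,\lambda_1)=(\lambda_0,x_1')$. **$\Gamma$-systems.** Let $\Gamma$ be an $l$-graph. A $\Gamma$-system $X$ of $k$-morphs (with data $\Lambda,\theta$) consists of a $k$-graph $\Lambda_v$ for each $v\in\Gamma^0$, a $\Lambda_{r(\gamma)}$--$\Lambda_{s(\gamma)}$ morph $X_\gamma$ for each $\gamma\in\Gamma$, and an isomorphism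 $\theta_{\alpha,\beta}:X_\alpha*_{\Lambda^0_{s(\alpha)}}X_\beta\to X_{\alpha\beta}$ for each composable pair, such that (1) $X_v=I_{\Lambda_v}$ for $v\in\Gamma^0$; (2) $\theta_{r(\gamma),\gamma}(r(x),x)=x$ and $\theta_{\gamma,s(\gamma)}(x,s(x))=x$ for $x\in X_\gamma$; (3) $\theta_{\alpha\beta,\gamma}\circ(\theta_{\alpha,\beta}\times\operatorname{id}_{X_\gamma})=\theta_{\alpha,\beta\gamma}\circ(\operatorname{id}_{X_\alpha}\times\theta_{\beta,\gamma})$ on $X_\alpha*X_\beta*X_\gamma$ for each composable triple. An isomorphism from a $\Gamma$-system $(\Lambda,X,\theta)$ to $(\Xi,Y,\psi)$ consists of $k$-graph isomorphisms $h^0_v:\Lambda_v\to\Xi_v$ ($v\in\Gamma^0$) and bijections $h_\gamma:X_\gamma\to Y_\gamma$ ($\gamma\in\Gamma$) with $s\circ h_\gamma=h^0_{s(\gamma)}\circ s$, $r\circ h_\gamma=h^0_{r(\gamma)}\circ r$, $(h^0_{r(\gamma)}\times h_\gamma)\circ\phi_{X_\gamma}=\phi_{Y_\gamma}\circ(h_\gamma\times h^0_{s(\gamma)})$, and $h_{\alpha\beta}\circ\theta_{\alpha,\beta}=\psi_{\alpha,\beta}\circ(h_\alpha\times h_\beta)$ for composable $\alpha,\beta$. **$\Gamma$-bundles.** Let $\pi:\mathbb{N}^{k+l}\to\mathbb{N}^l$ be the projection onto the last $l$ coordinates. Given a $(k+l)$-graph $\Sigma$ and a $\pi$-quasimorphism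 $f:\Sigma\to\Gamma$ restricting to a surjection $\Sigma^0\to\Gamma^0$, define a $\Gamma$-system $X(f)$ of $k$-morphs by: $\Lambda_v=f^{-1}(v)$ (a $k$-graph under the first $k$ coordinates of the degree map); $X(f)_\gamma=\{x\in f^{-1}(\gamma): d(x)=(0,d(\gamma))\}$ with the range and source maps of $\Sigma$ and $\phi(x,\lambda)=(\lambda',x')$ where $x\lambda=\lambda'x'$ is the factorisation in $\Sigma$ with $\lambda'\in\Lambda_{r(\gamma)}$, $x'\in X(f)_\gamma$; and $\theta_{\gamma_1,\gamma_2}$ given by composition in $\Sigma$. A $\Gamma$-bundle for a $\Gamma$-system $X$ is a $(k+l)$-graph $\Sigma$ together with such an $f$ (called the bundle map) for which $X(f)$ is isomorphic to $X$. *)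

theory Defs
  imports "HOL-Library.Function_Algebras" "HOL-Library.Countable_Set"
begin

(* The number of coordinates has to be a term, since k + l and the value 0 both occur.  The monoid
   of k-tuples of naturals is therefore the set of functions nat => nat vanishing from index k on,
   with the pointwise 0 and + of Function_Algebras; for k = 0 it is {0}. *)
definition natk :: "nat \<Rightarrow> (nat \<Rightarrow> nat) set" where
  "natk k = {n. \<forall>i\<ge>k. n i = 0}"

definition first_coords :: "nat \<Rightarrow> (nat \<Rightarrow> nat) \<Rightarrow> nat \<Rightarrow> nat" where
  "first_coords k n = (\<lambda>i. if i < k then n i else 0)"

(* On natk (k + l) this is the projection onto the last l coordinates. *)
definition last_coords :: "nat \<Rightarrow> (nat \<Rightarrow> nat) \<Rightarrow> nat \<Rightarrow> nat" where
  "last_coords k n = (\<lambda>i. n (k + i))"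

(* The element (m, n) of natk (k + l), for m in natk k and n in natk l. *)
definition join_coords :: "nat \<Rightarrow> (nat \<Rightarrow> nat) \<Rightarrow> (nat \<Rightarrow> nat) \<Rightarrow> nat \<Rightarrow> nat" where
  "join_coords k m n = (\<lambda>i. if i < k then m i else n (i - k))"


(* A small category is given by its arrows, an object being identified with its identity arrow;
   rng and src are codomain and domain.  The operations are total functions of which only the
   values on arrows (for cmp: on composable pairs) matter.  The product of x and y written xy is
   cmp x y, which needs src x = rng y. *)
record 'a graph_data =
  arr :: "'a set"
  rng :: "'a \<Rightarrow> 'a"
  src :: "'a \<Rightarrow> 'a"
  cmp :: "'a \<Rightarrow> 'a \<Rightarrow> 'a"
  deg :: "'a \<Rightarrow> nat \<Rightarrow> nat"

definition small_category :: "'a graph_data \<Rightarrow> bool" where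
  "small_category C \<longleftrightarrow>
     (\<forall>x\<in>arr C. rng C x \<in> arr C \<and> src C x \<in> arr C \<and>
        rng C (rng C x) = rng C x \<and> src C (rng C x) = rng C x \<and>
        rng C (src C x) = src C x \<and> src C (src C x) = src C x) \<and>
     (\<forall>x\<in>arr C. \<forall>y\<in>arr C. src C x = rng C y \<longrightarrow>
        cmp C x y \<in> arr C \<and> rng C (cmp C x y) = rng C x \<and> src C (cmp C x y) = src C y) \<and>
     (\<forall>x\<in>arr C. cmp C (rng C x) x = x \<and> cmp C x (src C x) = x) \<and>
     (\<forall>x\<in>arr C. \<forall>y\<in>arr C. \<forall>z\<in>arr C. src C x = rng C y \<and> src C y = rng C z \<longrightarrow>
        cmp C (cmp C x y) z = cmp C x (cmp C y z))"

definition degree_functor :: "nat \<Rightarrow> 'a graph_data \<Rightarrow> bool" where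
  "degree_functor k C \<longleftrightarrow>
     (\<forall>x\<in>arr C. deg C x \<in> natk k) \<and>
     (\<forall>x\<in>arr C. deg C (rng C x) = 0 \<and> deg C (src C x) = 0) \<and>
     (\<forall>x\<in>arr C. \<forall>y\<in>arr C. src C x = rng C y \<longrightarrow> deg C (cmp C x y) = deg C x + deg C y)"

definition factorisation_property :: "nat \<Rightarrow> 'a graph_data \<Rightarrow> bool" where
  "factorisation_property k C \<longleftrightarrow>
     (\<forall>x\<in>arr C. \<forall>m\<in>natk k. \<forall>n\<in>natk k. deg C x = m + n \<longrightarrow>
        (\<exists>!(y, z). y \<in> arr C \<and> z \<in> arr C \<and> deg C y = m \<and> deg C z = n \<and>
                   src C y = rng C z \<and> x = cmp C y z))"

definition k_graph :: "nat \<Rightarrow> 'a graph_data \<Rightarrow> bool" where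
  "k_graph k \<Lambda> \<longleftrightarrow> arr \<Lambda> \<noteq> {} \<and> countable (arr \<Lambda>) \<and>
     small_category \<Lambda> \<and> degree_functor k \<Lambda> \<and> factorisation_property k \<Lambda>"

definition vertices :: "'a graph_data \<Rightarrow> 'a set" where
  "vertices \<Lambda> = {x \<in> arr \<Lambda>. deg \<Lambda> x = 0}"

lemma vertices_eq_identities:
  assumes "k_graph k \<Lambda>"
  shows "vertices \<Lambda> = {x \<in> arr \<Lambda>. rng \<Lambda> x = x}"
proof (intro equalityI subsetI)
  fix x assume "x \<in> vertices \<Lambda>"
  then have x: "x \<in> arr \<Lambda>" "deg \<Lambda> x = 0" by (auto simp: vertices_def)
  have cat: "small_category \<Lambda>" and df: "degree_functor k \<Lambda>"
    and fp: "factorisation_property k \<Lambda>"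
    using assms by (auto simp: k_graph_def)
  have z: "0 \<in> natk k" by (simp add: natk_def)
  let ?P = "\<lambda>(y, z). y \<in> arr \<Lambda> \<and> z \<in> arr \<Lambda> \<and> deg \<Lambda> y = 0 \<and> deg \<Lambda> z = 0 \<and>
                   src \<Lambda> y = rng \<Lambda> z \<and> x = cmp \<Lambda> y z"
  have "\<exists>!p. ?P p"
    using fp[unfolded factorisation_property_def, THEN bspec, OF x(1), THEN bspec, OF z,
        THEN bspec, OF z] x(2) by simp
  moreover have "?P (rng \<Lambda> x, x)"
    using cat df x unfolding small_category_def degree_functor_def by auto
  moreover have "?P (x, src \<Lambda> x)"
    using cat df x unfolding small_category_def degree_functor_def by auto
  ultimately have "(rng \<Lambda> x, x) = (x, src \<Lambda> x)" by blast
  then show "x \<in> {x \<in> arr \<Lambda>. rng \<Lambda> x = x}" using x by simp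
next
  fix x assume "x \<in> {x \<in> arr \<Lambda>. rng \<Lambda> x = x}"
  then show "x \<in> vertices \<Lambda>"
    using assms by (force simp: vertices_def k_graph_def degree_functor_def)
qed

definition quasimorphism ::
  "((nat \<Rightarrow> nat) \<Rightarrow> nat \<Rightarrow> nat) \<Rightarrow> 'a graph_data \<Rightarrow> 'b graph_data \<Rightarrow> ('a \<Rightarrow> 'b) \<Rightarrow> bool" where
  "quasimorphism \<omega> \<Lambda> \<Gamma> f \<longleftrightarrow>
     (\<forall>x\<in>arr \<Lambda>. f x \<in> arr \<Gamma> \<and> f (rng \<Lambda> x) = rng \<Gamma> (f x) \<and> f (src \<Lambda> x) = src \<Gamma> (f x)) \<and>
     (\<forall>x\<in>arr \<Lambda>. \<forall>y\<in>arr \<Lambda>. src \<Lambda> x = rng \<Lambda> y \<longrightarrow> f (cmp \<Lambda> x y) = cmp \<Gamma> (f x) (f y)) \<and>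
     (\<forall>x\<in>arr \<Lambda>. deg \<Gamma> (f x) = \<omega> (deg \<Lambda> x))"

definition graph_iso :: "'a graph_data \<Rightarrow> 'b graph_data \<Rightarrow> ('a \<Rightarrow> 'b) \<Rightarrow> bool" where
  "graph_iso \<Lambda> \<Gamma> h \<longleftrightarrow> quasimorphism id \<Lambda> \<Gamma> h \<and> bij_betw h (arr \<Lambda>) (arr \<Gamma>)"


record ('a, 'x, 'b) morph_data =
  elts :: "'x set"
  mrng :: "'x \<Rightarrow> 'a"
  msrc :: "'x \<Rightarrow> 'b"
  phi :: "'x \<times> 'b \<Rightarrow> 'a \<times> 'x"

definition fibre_right :: "('a, 'x, 'b) morph_data \<Rightarrow> 'b graph_data \<Rightarrow> ('x \<times> 'b) set" where
  "fibre_right X \<Gamma> = {(x, \<gamma>). x \<in> elts X \<and> \<gamma> \<in> arr \<Gamma> \<and> msrc X x = rng \<Gamma> \<gamma>}"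

definition fibre_left :: "'a graph_data \<Rightarrow> ('a, 'x, 'b) morph_data \<Rightarrow> ('a \<times> 'x) set" where
  "fibre_left \<Lambda> X = {(a, x). a \<in> arr \<Lambda> \<and> x \<in> elts X \<and> src \<Lambda> a = mrng X x}"

definition k_morph ::
  "'a graph_data \<Rightarrow> 'b graph_data \<Rightarrow> ('a, 'x, 'b) morph_data \<Rightarrow> bool" where
  "k_morph \<Lambda> \<Gamma> X \<longleftrightarrow>
     countable (elts X) \<and> mrng X ` elts X \<subseteq> vertices \<Lambda> \<and> msrc X ` elts X \<subseteq> vertices \<Gamma> \<and>
     bij_betw (phi X) (fibre_right X \<Gamma>) (fibre_left \<Lambda> X) \<and>
     (\<forall>x1 c1 a1 x2. (x1, c1) \<in> fibre_right X \<Gamma> \<and> phi X (x1, c1) = (a1, x2) \<longrightarrow>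
        deg \<Gamma> c1 = deg \<Lambda> a1 \<and> src \<Gamma> c1 = msrc X x2 \<and> rng \<Lambda> a1 = mrng X x1 \<and>
        (\<forall>c2 a2 x3. (x2, c2) \<in> fibre_right X \<Gamma> \<and> phi X (x2, c2) = (a2, x3) \<longrightarrow>
           phi X (x1, cmp \<Gamma> c1 c2) = (cmp \<Lambda> a1 a2, x3)))"

definition morph_iso ::
  "'b graph_data \<Rightarrow> ('a, 'x, 'b) morph_data \<Rightarrow> ('a, 'y, 'b) morph_data \<Rightarrow> ('x \<Rightarrow> 'y) \<Rightarrow> bool" where
  "morph_iso \<Gamma> X Y \<theta> \<longleftrightarrow>
     bij_betw \<theta> (elts X) (elts Y) \<and>
     (\<forall>x\<in>elts X. mrng Y (\<theta> x) = mrng X x \<and> msrc Y (\<theta> x) = msrc X x) \<and>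
     (\<forall>p\<in>fibre_right X \<Gamma>. map_prod id \<theta> (phi X p) = phi Y (map_prod \<theta> id p))"

(* Equality of morphs as set-theoretic structures: record equality would also compare the values
   of the total functions outside their intended domains. *)
definition morph_eq ::
  "'b graph_data \<Rightarrow> ('a, 'x, 'b) morph_data \<Rightarrow> ('a, 'x, 'b) morph_data \<Rightarrow> bool" where
  "morph_eq \<Gamma> X Y \<longleftrightarrow> elts X = elts Y \<and>
     (\<forall>x\<in>elts X. mrng X x = mrng Y x \<and> msrc X x = msrc Y x) \<and>
     (\<forall>p\<in>fibre_right X \<Gamma>. phi X p = phi Y p)"

definition id_morph :: "'a graph_data \<Rightarrow> ('a, 'a, 'a) morph_data" where
  "id_morph \<Lambda> = \<lparr>elts = vertices \<Lambda>, mrng = id, msrc = id, phi = (\<lambda>(v, a). (a, src \<Lambda> a))\<rparr>"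

definition comp_morph ::
  "('a, 'x, 'b) morph_data \<Rightarrow> ('b, 'y, 'c) morph_data \<Rightarrow> ('a, 'x \<times> 'y, 'c) morph_data" where
  "comp_morph X1 X2 =
     \<lparr>elts = {(x1, x2). x1 \<in> elts X1 \<and> x2 \<in> elts X2 \<and> msrc X1 x1 = mrng X2 x2},
      mrng = (\<lambda>(x1, x2). mrng X1 x1),
      msrc = (\<lambda>(x1, x2). msrc X2 x2),
      phi = (\<lambda>((x1, x2), c).
        let (b, x2') = phi X2 (x2, c); (a, x1') = phi X1 (x1, b) in (a, (x1', x2')))\<rparr>"


(* All graphs and morphs of a system live on one type 'a: the system axioms require X_v to equal
   the identity morph, whose elements are arrows of the graph over v.  No disjointness is assumed.
   grph is only meaningful on vertices, mor on arrows, theta on composable pairs. *)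
record ('g, 'a) system_data =
  grph :: "'g \<Rightarrow> 'a graph_data"
  mor :: "'g \<Rightarrow> ('a, 'a, 'a) morph_data"
  theta :: "'g \<Rightarrow> 'g \<Rightarrow> 'a \<times> 'a \<Rightarrow> 'a"

definition gamma_system :: "nat \<Rightarrow> 'g graph_data \<Rightarrow> ('g, 'a) system_data \<Rightarrow> bool" where
  "gamma_system k \<Gamma> S \<longleftrightarrow>
     (\<forall>v\<in>vertices \<Gamma>. k_graph k (grph S v)) \<and>
     (\<forall>\<gamma>\<in>arr \<Gamma>. k_morph (grph S (rng \<Gamma> \<gamma>)) (grph S (src \<Gamma> \<gamma>)) (mor S \<gamma>)) \<and>
     (\<forall>\<alpha>\<in>arr \<Gamma>. \<forall>\<beta>\<in>arr \<Gamma>. src \<Gamma> \<alpha> = rng \<Gamma> \<beta> \<longrightarrow>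
        morph_iso (grph S (src \<Gamma> \<beta>)) (comp_morph (mor S \<alpha>) (mor S \<beta>)) (mor S (cmp \<Gamma> \<alpha> \<beta>))
          (theta S \<alpha> \<beta>)) \<and>
     (\<forall>v\<in>vertices \<Gamma>. morph_eq (grph S v) (mor S v) (id_morph (grph S v))) \<and>
     (\<forall>\<gamma>\<in>arr \<Gamma>. \<forall>x\<in>elts (mor S \<gamma>).
        theta S (rng \<Gamma> \<gamma>) \<gamma> (mrng (mor S \<gamma>) x, x) = x \<and>
        theta S \<gamma> (src \<Gamma> \<gamma>) (x, msrc (mor S \<gamma>) x) = x) \<and>
     (\<forall>\<alpha>\<in>arr \<Gamma>. \<forall>\<beta>\<in>arr \<Gamma>. \<forall>\<gamma>\<in>arr \<Gamma>. src \<Gamma> \<alpha> = rng \<Gamma> \<beta> \<and> src \<Gamma> \<beta> = rng \<Gamma> \<gamma> \<longrightarrow>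
        (\<forall>x\<in>elts (mor S \<alpha>). \<forall>y\<in>elts (mor S \<beta>). \<forall>z\<in>elts (mor S \<gamma>).
           msrc (mor S \<alpha>) x = mrng (mor S \<beta>) y \<and> msrc (mor S \<beta>) y = mrng (mor S \<gamma>) z \<longrightarrow>
           theta S (cmp \<Gamma> \<alpha> \<beta>) \<gamma> (theta S \<alpha> \<beta> (x, y), z) =
           theta S \<alpha> (cmp \<Gamma> \<beta> \<gamma>) (x, theta S \<beta> \<gamma> (y, z))))"

definition system_iso ::
  "'g graph_data \<Rightarrow> ('g, 'a) system_data \<Rightarrow> ('g, 'b) system_data \<Rightarrow>
     ('g \<Rightarrow> 'a \<Rightarrow> 'b) \<Rightarrow> ('g \<Rightarrow> 'a \<Rightarrow> 'b) \<Rightarrow> bool" where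
  "system_iso \<Gamma> S T h0 h \<longleftrightarrow>
     (\<forall>v\<in>vertices \<Gamma>. graph_iso (grph S v) (grph T v) (h0 v)) \<and>
     (\<forall>\<gamma>\<in>arr \<Gamma>.
        bij_betw (h \<gamma>) (elts (mor S \<gamma>)) (elts (mor T \<gamma>)) \<and>
        (\<forall>x\<in>elts (mor S \<gamma>).
           msrc (mor T \<gamma>) (h \<gamma> x) = h0 (src \<Gamma> \<gamma>) (msrc (mor S \<gamma>) x) \<and>
           mrng (mor T \<gamma>) (h \<gamma> x) = h0 (rng \<Gamma> \<gamma>) (mrng (mor S \<gamma>) x)) \<and>
        (\<forall>p\<in>fibre_right (mor S \<gamma>) (grph S (src \<Gamma> \<gamma>)).
           map_prod (h0 (rng \<Gamma> \<gamma>)) (h \<gamma>) (phi (mor S \<gamma>) p) =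
           phi (mor T \<gamma>) (map_prod (h \<gamma>) (h0 (src \<Gamma> \<gamma>)) p))) \<and>
     (\<forall>\<alpha>\<in>arr \<Gamma>. \<forall>\<beta>\<in>arr \<Gamma>. src \<Gamma> \<alpha> = rng \<Gamma> \<beta> \<longrightarrow>
        (\<forall>p\<in>elts (comp_morph (mor S \<alpha>) (mor S \<beta>)).
           h (cmp \<Gamma> \<alpha> \<beta>) (theta S \<alpha> \<beta> p) = theta T \<alpha> \<beta> (map_prod (h \<alpha>) (h \<beta>) p)))"

definition system_isomorphic ::
  "'g graph_data \<Rightarrow> ('g, 'a) system_data \<Rightarrow> ('g, 'b) system_data \<Rightarrow> bool" where
  "system_isomorphic \<Gamma> S T \<longleftrightarrow> (\<exists>h0 h. system_iso \<Gamma> S T h0 h)"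


definition bundle_fibre ::
  "nat \<Rightarrow> 's graph_data \<Rightarrow> ('s \<Rightarrow> 'g) \<Rightarrow> 'g \<Rightarrow> 's graph_data" where
  "bundle_fibre k \<Sigma> f v =
     \<lparr>arr = {x \<in> arr \<Sigma>. f x = v}, rng = rng \<Sigma>, src = src \<Sigma>, cmp = cmp \<Sigma>,
      deg = (\<lambda>x. first_coords k (deg \<Sigma> x))\<rparr>"

definition bundle_elts ::
  "nat \<Rightarrow> 'g graph_data \<Rightarrow> 's graph_data \<Rightarrow> ('s \<Rightarrow> 'g) \<Rightarrow> 'g \<Rightarrow> 's set" where
  "bundle_elts k \<Gamma> \<Sigma> f \<gamma> = {x \<in> arr \<Sigma>. f x = \<gamma> \<and> deg \<Sigma> x = join_coords k 0 (deg \<Gamma> \<gamma>)}"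

definition bundle_morph ::
  "nat \<Rightarrow> 'g graph_data \<Rightarrow> 's graph_data \<Rightarrow> ('s \<Rightarrow> 'g) \<Rightarrow> 'g \<Rightarrow> ('s, 's, 's) morph_data" where
  "bundle_morph k \<Gamma> \<Sigma> f \<gamma> =
     \<lparr>elts = bundle_elts k \<Gamma> \<Sigma> f \<gamma>, mrng = rng \<Sigma>, msrc = src \<Sigma>,
      phi = (\<lambda>(x, a). THE (a', x').
        a' \<in> arr (bundle_fibre k \<Sigma> f (rng \<Gamma> \<gamma>)) \<and> x' \<in> bundle_elts k \<Gamma> \<Sigma> f \<gamma> \<and>
        src \<Sigma> a' = rng \<Sigma> x' \<and> cmp \<Sigma> x a = cmp \<Sigma> a' x')\<rparr>"

definition system_of ::
  "nat \<Rightarrow> 'g graph_data \<Rightarrow> 's graph_data \<Rightarrow> ('s \<Rightarrow> 'g) \<Rightarrow> ('g, 's) system_data" where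
  "system_of k \<Gamma> \<Sigma> f =
     \<lparr>grph = bundle_fibre k \<Sigma> f, mor = bundle_morph k \<Gamma> \<Sigma> f,
      theta = (\<lambda>\<alpha> \<beta> (x, y). cmp \<Sigma> x y)\<rparr>"

definition gamma_bundle ::
  "nat \<Rightarrow> nat \<Rightarrow> 'g graph_data \<Rightarrow> ('g, 'a) system_data \<Rightarrow>
     's graph_data \<Rightarrow> ('s \<Rightarrow> 'g) \<Rightarrow> bool" where
  "gamma_bundle k l \<Gamma> S \<Sigma> f \<longleftrightarrow>
     k_graph (k + l) \<Sigma> \<and> quasimorphism (last_coords k) \<Sigma> \<Gamma> f \<and>
     f ` vertices \<Sigma> = vertices \<Gamma> \<and>
     system_isomorphic \<Gamma> (system_of k \<Gamma> \<Sigma> f) S"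

end

theory Submission
  imports Defs
begin

text \<open>
  The arrows of the bundle over \<open>\<gamma>\<close> are the formal products \<open>a x\<close> with \<open>a\<close> an arrow of the graph over
  \<open>r(\<gamma>)\<close> and \<open>x\<close> an element of \<open>X\<^sub>\<gamma>\<close>.  The bijection \<open>\<phi>\<close> moves \<open>x\<close> past \<open>b\<close> in the product
  \<open>a x b y = a b' x' y\<close>, and \<open>\<theta>\<close> multiplies \<open>x'\<close> with \<open>y\<close>; factorisations exist and are unique because
  \<open>\<phi>\<close> and \<open>\<theta>\<close> are bijective.  Conversely, in any bundle each arrow factors uniquely as \<open>a x\<close> with \<open>a\<close> of
  degree \<open>(m, 0)\<close> and \<open>x\<close> of degree \<open>(0, n)\<close>, which identifies the bundle with the formal one.
\<close>

section \<open>Coordinates\<close>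

text \<open>The tag \<open>\<gamma>\<close> in a triple \<open>(\<gamma>, a, x)\<close> is
  essential: all graphs and morphs of the system share one type and may overlap, so \<open>a\<close>
  and \<open>x\<close> alone do not reveal the fibre they come from. Graph arrows stand on the left
  because \<open>phi\<close> is oriented that way: it carries (x, b) to (b', x'). Associativity
  combines associativity in the base, in the graphs and of \<open>theta\<close> with two
  compatibilities: \<open>phi\<close> respects composition of graph arrows, and \<open>theta\<close>
  intertwines the \<open>phi\<close> maps. The delicate law is the right unit, which needs phi(x,
  s(x)) = (r(x), x); this is not among the axioms of a morph and has to be derived from them. For
  uniqueness, the comparison map is built from an isomorphism of systems. Its maps on graphs and on
  morphs are separate data; that they agree on vertices follows from X_v being the identity morph.
  Two bundles are never compared directly: each is compared with the formal one, so they may live on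
  different types.\<close>

lemma join_coords_add:
  "join_coords k m n + join_coords k m' n' = join_coords k (m + m') (n + n')"
  by (auto simp: join_coords_def plus_fun_def)

lemma join_coords_zero [simp]: "join_coords k 0 0 = 0"
  by (auto simp: join_coords_def)

lemma join_coords_first_last [simp]: "join_coords k (first_coords k n) (last_coords k n) = n"
  by (auto simp: join_coords_def first_coords_def last_coords_def)

lemma last_coords_join [simp]: "last_coords k (join_coords k m n) = n"
  by (auto simp: join_coords_def last_coords_def)

lemma first_coords_join [simp]: "m \<in> natk k \<Longrightarrow> first_coords k (join_coords k m n) = m"
  by (auto simp: join_coords_def first_coords_def natk_def)

lemma last_coords_add: "last_coords k (m + n) = last_coords k m + last_coords k n"
  by (auto simp: last_coords_def)

lemma first_coords_add: "first_coords k (m + n) = first_coords k m + first_coords k n"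
  by (auto simp: first_coords_def)

lemma coords_zero [simp]: "first_coords k 0 = 0" "last_coords k 0 = 0"
  by (auto simp: last_coords_def first_coords_def)

lemma first_coords_natk [simp]: "first_coords k n \<in> natk k"
  by (auto simp: natk_def first_coords_def)

lemma last_coords_natk: "n \<in> natk (k + l) \<Longrightarrow> last_coords k n \<in> natk l"
  by (auto simp: natk_def last_coords_def)

lemma join_coords_natk: "n \<in> natk l \<Longrightarrow> join_coords k m n \<in> natk (k + l)"
  by (auto simp: natk_def join_coords_def)

lemma zero_natk [simp]: "0 \<in> natk k"
  by (simp add: natk_def)


section \<open>Graphs and morphs\<close>

lemma k_graph_arr:
  assumes "k_graph k \<Lambda>" "x \<in> arr \<Lambda>"
  shows "rng \<Lambda> x \<in> arr \<Lambda>" "src \<Lambda> x \<in> arr \<Lambda>"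
    "rng \<Lambda> (rng \<Lambda> x) = rng \<Lambda> x" "src \<Lambda> (rng \<Lambda> x) = rng \<Lambda> x"
    "rng \<Lambda> (src \<Lambda> x) = src \<Lambda> x" "src \<Lambda> (src \<Lambda> x) = src \<Lambda> x"
    "cmp \<Lambda> (rng \<Lambda> x) x = x" "cmp \<Lambda> x (src \<Lambda> x) = x"
    "deg \<Lambda> x \<in> natk k" "deg \<Lambda> (rng \<Lambda> x) = 0" "deg \<Lambda> (src \<Lambda> x) = 0"
    "rng \<Lambda> x \<in> vertices \<Lambda>" "src \<Lambda> x \<in> vertices \<Lambda>"
  using assms unfolding k_graph_def small_category_def degree_functor_def vertices_def by blast+

lemma k_graph_cmp:
  assumes "k_graph k \<Lambda>" "x \<in> arr \<Lambda>" "y \<in> arr \<Lambda>" "src \<Lambda> x = rng \<Lambda> y"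
  shows "cmp \<Lambda> x y \<in> arr \<Lambda>" "rng \<Lambda> (cmp \<Lambda> x y) = rng \<Lambda> x" "src \<Lambda> (cmp \<Lambda> x y) = src \<Lambda> y"
    "deg \<Lambda> (cmp \<Lambda> x y) = deg \<Lambda> x + deg \<Lambda> y"
  using assms by (auto simp: k_graph_def small_category_def degree_functor_def)

lemma k_graph_assoc:
  assumes "k_graph k \<Lambda>" "x \<in> arr \<Lambda>" "y \<in> arr \<Lambda>" "z \<in> arr \<Lambda>"
    "src \<Lambda> x = rng \<Lambda> y" "src \<Lambda> y = rng \<Lambda> z"
  shows "cmp \<Lambda> (cmp \<Lambda> x y) z = cmp \<Lambda> x (cmp \<Lambda> y z)"
  using assms by (auto simp: k_graph_def small_category_def)

lemma vertex_arr:
  assumes "k_graph k \<Lambda>" "v \<in> vertices \<Lambda>"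
  shows "v \<in> arr \<Lambda>" "rng \<Lambda> v = v" "src \<Lambda> v = v" "deg \<Lambda> v = 0"
proof -
  show "v \<in> arr \<Lambda>" "rng \<Lambda> v = v" "deg \<Lambda> v = 0"
    using assms vertices_eq_identities[OF assms(1)] by (auto simp: vertices_def)
  then show "src \<Lambda> v = v" using k_graph_arr(4)[OF assms(1), of v] by simp
qed

lemma vertices_nonempty:
  assumes "k_graph m \<Lambda>"
  obtains w where "w \<in> vertices \<Lambda>"
  using assms k_graph_arr(12)[OF assms] by (auto simp: k_graph_def)

lemma k_graph_factor:
  assumes "k_graph k \<Lambda>" "x \<in> arr \<Lambda>" "m \<in> natk k" "n \<in> natk k" "deg \<Lambda> x = m + n"
  obtains y z where "y \<in> arr \<Lambda>" "z \<in> arr \<Lambda>" "deg \<Lambda> y = m" "deg \<Lambda> z = n"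
    "src \<Lambda> y = rng \<Lambda> z" "x = cmp \<Lambda> y z"
proof -
  have "\<exists>!(y, z). y \<in> arr \<Lambda> \<and> z \<in> arr \<Lambda> \<and> deg \<Lambda> y = m \<and> deg \<Lambda> z = n \<and>
          src \<Lambda> y = rng \<Lambda> z \<and> x = cmp \<Lambda> y z"
    using assms by (simp add: k_graph_def factorisation_property_def)
  then show thesis using that by blast
qed

lemma k_graph_factor_unique:
  assumes "k_graph k \<Lambda>" and arr: "y \<in> arr \<Lambda>" "z \<in> arr \<Lambda>" "y' \<in> arr \<Lambda>" "z' \<in> arr \<Lambda>"
    and eq: "src \<Lambda> y = rng \<Lambda> z" "src \<Lambda> y' = rng \<Lambda> z'"
    "deg \<Lambda> y = deg \<Lambda> y'" "deg \<Lambda> z = deg \<Lambda> z'" "cmp \<Lambda> y z = cmp \<Lambda> y' z'"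
  shows "y = y' \<and> z = z'"
proof -
  let ?P = "\<lambda>(a, b). a \<in> arr \<Lambda> \<and> b \<in> arr \<Lambda> \<and> deg \<Lambda> a = deg \<Lambda> y \<and> deg \<Lambda> b = deg \<Lambda> z \<and>
          src \<Lambda> a = rng \<Lambda> b \<and> cmp \<Lambda> y z = cmp \<Lambda> a b"
  have fp: "factorisation_property k \<Lambda>" using assms(1) by (simp add: k_graph_def)
  have "\<exists>!p. ?P p"
    using fp[unfolded factorisation_property_def, THEN bspec, OF k_graph_cmp(1)[OF assms(1-3) eq(1)],
        THEN bspec, OF k_graph_arr(9)[OF assms(1) arr(1)],
        THEN bspec, OF k_graph_arr(9)[OF assms(1) arr(2)]]
      k_graph_cmp(4)[OF assms(1-3) eq(1)] by simp
  moreover have "?P (y, z)" "?P (y', z')" using arr eq by auto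
  ultimately have "(y, z) = (y', z')" by blast
  then show ?thesis by simp
qed

lemma k_morph_elts:
  assumes "k_morph \<Lambda> \<Gamma> X" "x \<in> elts X"
  shows "mrng X x \<in> vertices \<Lambda>" "msrc X x \<in> vertices \<Gamma>"
  using assms by (auto simp: k_morph_def)

lemma k_morph_phi:
  assumes "k_morph \<Lambda> \<Gamma> X" "x \<in> elts X" "c \<in> arr \<Gamma>" "msrc X x = rng \<Gamma> c"
  obtains a y where "phi X (x, c) = (a, y)" "a \<in> arr \<Lambda>" "y \<in> elts X" "src \<Lambda> a = mrng X y"
    "deg \<Lambda> a = deg \<Gamma> c" "src \<Gamma> c = msrc X y" "rng \<Lambda> a = mrng X x"
proof -
  obtain a y where ay: "phi X (x, c) = (a, y)" by fastforce
  have in_fr: "(x, c) \<in> fibre_right X \<Gamma>" using assms by (simp add: fibre_right_def)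
  then have "phi X (x, c) \<in> fibre_left \<Lambda> X"
    using assms(1) by (auto simp: k_morph_def bij_betw_def)
  moreover have "deg \<Gamma> c = deg \<Lambda> a \<and> src \<Gamma> c = msrc X y \<and> rng \<Lambda> a = mrng X x"
    using assms(1) in_fr ay unfolding k_morph_def by blast
  ultimately show thesis using that[OF ay] ay by (auto simp: fibre_left_def)
qed

lemma k_morph_phi_cmp:
  assumes "k_morph \<Lambda> \<Gamma> X" "x \<in> elts X" "c \<in> arr \<Gamma>" "msrc X x = rng \<Gamma> c" "c' \<in> arr \<Gamma>"
    "src \<Gamma> c = rng \<Gamma> c'" "phi X (x, c) = (a, y)" "phi X (y, c') = (a', z)"
  shows "phi X (x, cmp \<Gamma> c c') = (cmp \<Lambda> a a', z)"
proof -
  have "(x, c) \<in> fibre_right X \<Gamma>" using assms by (simp add: fibre_right_def)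
  moreover obtain b y' where "phi X (x, c) = (b, y')" "y' \<in> elts X" "src \<Gamma> c = msrc X y'"
    using assms(1-4) k_morph_phi by metis
  then have "(y, c') \<in> fibre_right X \<Gamma>" using assms by (simp add: fibre_right_def)
  ultimately show ?thesis using assms(1,7,8) unfolding k_morph_def by blast
qed

lemma k_morph_phi_inj:
  assumes "k_morph \<Lambda> \<Gamma> X" "x \<in> elts X" "c \<in> arr \<Gamma>" "msrc X x = rng \<Gamma> c"
    "x' \<in> elts X" "c' \<in> arr \<Gamma>" "msrc X x' = rng \<Gamma> c'" "phi X (x, c) = phi X (x', c')"
  shows "x = x' \<and> c = c'"
proof -
  have "inj_on (phi X) (fibre_right X \<Gamma>)" using assms(1) by (simp add: k_morph_def bij_betw_def)
  moreover have "(x, c) \<in> fibre_right X \<Gamma>" "(x', c') \<in> fibre_right X \<Gamma>"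
    using assms by (auto simp: fibre_right_def)
  ultimately show ?thesis using assms(8) by (auto dest: inj_onD)
qed

lemma k_morph_phi_surj:
  assumes "k_morph \<Lambda> \<Gamma> X" "a \<in> arr \<Lambda>" "y \<in> elts X" "src \<Lambda> a = mrng X y"
  obtains x c where "x \<in> elts X" "c \<in> arr \<Gamma>" "msrc X x = rng \<Gamma> c" "phi X (x, c) = (a, y)"
proof -
  have "(a, y) \<in> phi X ` fibre_right X \<Gamma>"
    using assms by (auto simp: k_morph_def bij_betw_def fibre_left_def)
  then show thesis using that by (auto simp: fibre_right_def)
qed

text \<open>Since \<open>phi\<close> preserves degree, a vertex can only be moved to a vertex, and
  matching ranges identifies that vertex as r(x). That the element \<open>x\<close> itself is
  unchanged comes from s(x) being idempotent together with injectivity of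
  \<open>phi\<close>.\<close>

lemma k_morph_phi_vertex:
  assumes L: "k_graph k \<Lambda>" and G: "k_graph k \<Gamma>" and X: "k_morph \<Lambda> \<Gamma> X" and x: "x \<in> elts X"
  shows "phi X (x, msrc X x) = (mrng X x, x)"
proof -
  let ?s = "msrc X x"
  note s = vertex_arr[OF G k_morph_elts(2)[OF X x]]
  have vert: "a = mrng X y"
    if "y \<in> elts X" "msrc X y = ?s" "phi X (y, ?s) = (a, z)" for y a z
  proof -
    from that have "msrc X y = rng \<Gamma> ?s" using s by simp
    from k_morph_phi[OF X that(1) s(1) this] obtain a' z' where
      "phi X (y, ?s) = (a', z')" "a' \<in> arr \<Lambda>" "deg \<Lambda> a' = deg \<Gamma> ?s" "rng \<Lambda> a' = mrng X y"
      by metis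
    then show ?thesis using that s vertex_arr(2)[OF L, of a] by (auto simp: vertices_def)
  qed
  obtain a y where y: "phi X (x, ?s) = (a, y)" "a \<in> arr \<Lambda>" "y \<in> elts X" "src \<Lambda> a = mrng X y"
    "src \<Gamma> ?s = msrc X y"
    using k_morph_phi[OF X x s(1)] s(2) by metis
  have ys: "msrc X y = ?s" using y s by simp
  obtain b z where z: "phi X (y, ?s) = (b, z)" by fastforce
  have a: "a = mrng X x" and b: "b = mrng X y"
    using vert[OF x _ y(1)] vert[OF y(3) ys z] by auto
  \<comment> \<open>Moving \<open>?s\<close> past \<open>x\<close> twice is the same as moving it
    once, so \<open>z = y\<close>. Then (y, ?s) and (x, ?s) have the same image under
    \<open>phi\<close>.\<close>
  have "cmp \<Gamma> ?s ?s = ?s" using k_graph_arr(7)[OF G s(1)] s by simp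
  then have "(a, y) = (cmp \<Lambda> a b, z)"
    using k_morph_phi_cmp[OF X x s(1) _ s(1) _ y(1) z] s y(1) by simp
  moreover have "a = b"
    using a b y(4) vertex_arr(3)[OF L k_morph_elts(1)[OF X x]] by simp
  ultimately have "phi X (y, ?s) = phi X (x, ?s)" using z y(1) by simp
  then have "y = x" using k_morph_phi_inj[OF X y(3) s(1) _ x s(1)] ys s by simp
  then show ?thesis using y(1) a by simp
qed

text \<open>The inverse function is controlled only on images of arrows of \<open>C\<close>, so
  \<open>C\<close> has to be closed under range, source and composition;
  \<open>small_category\<close> supplies this.\<close>

lemma graph_iso_inv:
  assumes C: "small_category C" and h: "graph_iso C D h"
  shows "graph_iso D C (the_inv_into (arr C) h)"
proof -
  have b: "bij_betw h (arr C) (arr D)" and q: "quasimorphism id C D h"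
    using h by (auto simp: graph_iso_def)
  let ?i = "the_inv_into (arr C) h"
  have ih: "?i (h x) = x" if "x \<in> arr C" for x
    using b that by (simp add: bij_betw_def the_inv_into_f_f)
  have ex: "\<exists>x\<in>arr C. y = h x" if "y \<in> arr D" for y
    using b that by (auto simp: bij_betw_def)
  have inj: "x = x'" if "h x = h x'" "x \<in> arr C" "x' \<in> arr C" for x x'
    using that ih by metis
  have hr: "rng D (h x) = h (rng C x)" "src D (h x) = h (src C x)" "deg D (h x) = deg C x"
    and Cr: "rng C x \<in> arr C" "src C x \<in> arr C" if "x \<in> arr C" for x
    using q C that by (auto simp: quasimorphism_def small_category_def)
  have hc: "cmp D (h x) (h y) = h (cmp C x y)" "cmp C x y \<in> arr C"
    if "x \<in> arr C" "y \<in> arr C" "src C x = rng C y" for x y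
    using q C that by (auto simp: quasimorphism_def small_category_def)
  have "quasimorphism id D C ?i"
    unfolding quasimorphism_def
  proof (intro conjI ballI impI)
    fix x y assume xy: "x \<in> arr D" "y \<in> arr D" "src D x = rng D y"
    then obtain x' y' where "x = h x'" "x' \<in> arr C" "y = h y'" "y' \<in> arr C" using ex by metis
    moreover from this xy have "src C x' = rng C y'" using hr Cr inj by metis
    ultimately show "?i (cmp D x y) = cmp C (?i x) (?i y)" using hc ih by simp
  qed (use ex hr Cr ih in fastforce)+
  then show ?thesis using bij_betw_the_inv_into[OF b] by (simp add: graph_iso_def)
qed

lemma graph_iso_comp:
  assumes "graph_iso C D h" "graph_iso D E h'"
  shows "graph_iso C E (h' \<circ> h)"
  using assms by (auto simp: graph_iso_def quasimorphism_def intro: bij_betw_trans) metis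


section \<open>Graphs over a base graph\<close>

text \<open>The setting common to the formal bundle and to an arbitrary one, so that the normal form
  ax is established once for both.\<close>

locale graph_over =
  fixes k l :: nat and \<Gamma> :: "'g graph_data" and \<Sigma> :: "'s graph_data" and f :: "'s \<Rightarrow> 'g"
  assumes base: "k_graph l \<Gamma>" and tot: "k_graph (k + l) \<Sigma>"
    and proj: "quasimorphism (last_coords k) \<Sigma> \<Gamma> f"
begin

abbreviation "E \<equiv> bundle_elts k \<Gamma> \<Sigma> f"

lemma proj_arr:
  assumes "x \<in> arr \<Sigma>"
  shows "f x \<in> arr \<Gamma>" "f (rng \<Sigma> x) = rng \<Gamma> (f x)" "f (src \<Sigma> x) = src \<Gamma> (f x)"
    "deg \<Gamma> (f x) = last_coords k (deg \<Sigma> x)"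
  using proj assms by (auto simp: quasimorphism_def)

lemma proj_cmp:
  assumes "x \<in> arr \<Sigma>" "y \<in> arr \<Sigma>" "src \<Sigma> x = rng \<Sigma> y"
  shows "f (cmp \<Sigma> x y) = cmp \<Gamma> (f x) (f y)"
  using proj assms by (auto simp: quasimorphism_def)

lemma elts_arr: "x \<in> E \<gamma> \<Longrightarrow> x \<in> arr \<Sigma>" "x \<in> E \<gamma> \<Longrightarrow> f x = \<gamma>"
  by (auto simp: bundle_elts_def)

text \<open>Factoring along (p, 0) + (0, q) leaves all of the base degree in the right factor. The
  left factor then lies over a vertex, so projecting the product returns the projection of
  \<open>x\<close>.\<close>

lemma split_ex:
  assumes "\<sigma> \<in> arr \<Sigma>"
  obtains a x where "a \<in> arr \<Sigma>" "f a = rng \<Gamma> (f \<sigma>)" "x \<in> E (f \<sigma>)" "src \<Sigma> a = rng \<Sigma> x"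
    "\<sigma> = cmp \<Sigma> a x"
proof -
  let ?p = "first_coords k (deg \<Sigma> \<sigma>)" and ?q = "last_coords k (deg \<Sigma> \<sigma>)"
  have "?q \<in> natk l" using k_graph_arr(9)[OF tot assms] by (rule last_coords_natk)
  then have "join_coords k ?p 0 \<in> natk (k + l)" "join_coords k 0 ?q \<in> natk (k + l)"
    by (auto intro: join_coords_natk)
  moreover have "deg \<Sigma> \<sigma> = join_coords k ?p 0 + join_coords k 0 ?q"
    by (simp add: join_coords_add)
  ultimately obtain a x where ax: "a \<in> arr \<Sigma>" "x \<in> arr \<Sigma>" "deg \<Sigma> a = join_coords k ?p 0"
    "deg \<Sigma> x = join_coords k 0 ?q" "src \<Sigma> a = rng \<Sigma> x" "\<sigma> = cmp \<Sigma> a x"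
    using k_graph_factor[OF tot assms] by metis
  have "f a \<in> vertices \<Gamma>"
    using proj_arr[OF ax(1)] ax(3) by (simp add: vertices_def)
  note v = vertex_arr[OF base this]
  have s: "src \<Gamma> (f a) = rng \<Gamma> (f x)"
    using proj_arr(3)[OF ax(1)] proj_arr(2)[OF ax(2)] ax(5) by simp
  then have "f \<sigma> = f x"
    using proj_cmp[OF ax(1,2,5)] ax(6) v k_graph_arr(7)[OF base proj_arr(1)[OF ax(2)]] by simp
  moreover have "f a = rng \<Gamma> (f x)" using s v by simp
  moreover have "x \<in> E (f x)" using ax(2,4) proj_arr(4)[OF ax(2)] by (simp add: bundle_elts_def)
  ultimately show thesis using that ax by simp
qed

text \<open>All elements of \<open>E \<gamma>\<close> have the one degree (0, d(\<gamma>)).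
  Cancelling it from the degree of the product forces \<open>a\<close> and \<open>a'\<close> to have
  equal degree, which is what unique factorisation asks for.\<close>

lemma split_unique:
  assumes "a \<in> arr \<Sigma>" "a' \<in> arr \<Sigma>" "x \<in> E \<gamma>" "x' \<in> E \<gamma>"
    "src \<Sigma> a = rng \<Sigma> x" "src \<Sigma> a' = rng \<Sigma> x'" "cmp \<Sigma> a x = cmp \<Sigma> a' x'"
  shows "a = a' \<and> x = x'"
proof -
  have x: "x \<in> arr \<Sigma>" "x' \<in> arr \<Sigma>" "deg \<Sigma> x = deg \<Sigma> x'"
    using assms(3,4) by (auto simp: bundle_elts_def)
  have "deg \<Sigma> a + deg \<Sigma> x = deg \<Sigma> a' + deg \<Sigma> x'"
    using k_graph_cmp(4)[OF tot assms(1) x(1) assms(5)]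
      k_graph_cmp(4)[OF tot assms(2) x(2) assms(6)] assms(7) by simp
  then have "deg \<Sigma> a = deg \<Sigma> a'" using x(3) by simp
  then show ?thesis using k_graph_factor_unique[OF tot assms(1) x(1) assms(2) x(2)] assms x by simp
qed

text \<open>Evaluates the definite description in \<open>bundle_morph\<close>: by
  \<open>split_unique\<close>, any factorisation of the right shape is its value.\<close>

lemma bundle_phi:
  assumes "b \<in> arr \<Sigma>" "f b = rng \<Gamma> \<gamma>" "y \<in> E \<gamma>" "src \<Sigma> b = rng \<Sigma> y"
    "cmp \<Sigma> x a = cmp \<Sigma> b y"
  shows "phi (bundle_morph k \<Gamma> \<Sigma> f \<gamma>) (x, a) = (b, y)"
  unfolding bundle_morph_def
  using assms by (auto intro!: the_equality simp: bundle_fibre_def dest: split_unique)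

lemma proj_cmp_fibre:
  assumes "a \<in> arr \<Sigma>" "x \<in> E \<gamma>" "src \<Sigma> a = rng \<Sigma> x" "f a = rng \<Gamma> \<gamma>"
  shows "f (cmp \<Sigma> a x) = \<gamma>"
  using proj_cmp[OF assms(1) elts_arr(1)[OF assms(2)] assms(3)] assms elts_arr[OF assms(2)]
    k_graph_arr(7)[OF base, of \<gamma>] proj_arr(1)[of x] by simp

lemma bundle_phi_ex:
  assumes x: "x \<in> E \<gamma>" and a: "a \<in> arr \<Sigma>" "f a = src \<Gamma> \<gamma>" "src \<Sigma> x = rng \<Sigma> a"
  obtains b y where "phi (bundle_morph k \<Gamma> \<Sigma> f \<gamma>) (x, a) = (b, y)"
    "b \<in> arr \<Sigma>" "f b = rng \<Gamma> \<gamma>" "y \<in> E \<gamma>" "src \<Sigma> b = rng \<Sigma> y" "cmp \<Sigma> x a = cmp \<Sigma> b y"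
proof -
  note xa = elts_arr[OF x]
  have \<gamma>: "\<gamma> \<in> arr \<Gamma>" using proj_arr(1)[OF xa(1)] xa(2) by simp
  have f: "f (cmp \<Sigma> x a) = \<gamma>"
    using proj_cmp[OF xa(1) a(1,3)] a(2) xa(2) k_graph_arr(8)[OF base \<gamma>] by simp
  obtain b y where bfac: "b \<in> arr \<Sigma>" "f b = rng \<Gamma> \<gamma>" "y \<in> E \<gamma>" "src \<Sigma> b = rng \<Sigma> y"
    "cmp \<Sigma> x a = cmp \<Sigma> b y"
    using split_ex[OF k_graph_cmp(1)[OF tot xa(1) a(1,3)]] f by metis
  show thesis using that[OF bundle_phi[OF bfac] bfac] .
qed

end


section \<open>The total graph of a system\<close>

text \<open>The triple \<open>(\<gamma>, a, x)\<close> stands for the product ax. The identity at a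
  vertex w over v is (v, w, w), since the elements of X_v are the vertices of the graph over v;
  hence the repeated \<open>w\<close> in \<open>rng\<close> and \<open>src\<close>.\<close>

definition total_graph ::
  "nat \<Rightarrow> 'g graph_data \<Rightarrow> ('g, 'a) system_data \<Rightarrow> ('g \<times> 'a \<times> 'a) graph_data" where
  "total_graph k \<Gamma> X =
     \<lparr>arr = {(\<gamma>, a, x). \<gamma> \<in> arr \<Gamma> \<and> a \<in> arr (grph X (rng \<Gamma> \<gamma>)) \<and> x \<in> elts (mor X \<gamma>) \<and>
        src (grph X (rng \<Gamma> \<gamma>)) a = mrng (mor X \<gamma>) x},
      rng = (\<lambda>(\<gamma>, a, x). let w = rng (grph X (rng \<Gamma> \<gamma>)) a in (rng \<Gamma> \<gamma>, w, w)),
      src = (\<lambda>(\<gamma>, a, x). let w = msrc (mor X \<gamma>) x in (src \<Gamma> \<gamma>, w, w)),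
      cmp = (\<lambda>(\<gamma>, a, x) (\<delta>, b, y). let (b', x') = phi (mor X \<gamma>) (x, b) in
        (cmp \<Gamma> \<gamma> \<delta>, cmp (grph X (rng \<Gamma> \<gamma>)) a b', theta X \<gamma> \<delta> (x', y))),
      deg = (\<lambda>(\<gamma>, a, x). join_coords k (deg (grph X (rng \<Gamma> \<gamma>)) a) (deg \<Gamma> \<gamma>))\<rparr>"

locale graph_system =
  fixes k l :: nat and \<Gamma> :: "'g graph_data" and X :: "('g, 'a) system_data"
  assumes base: "k_graph l \<Gamma>" and sys: "gamma_system k \<Gamma> X"
begin

abbreviation "G \<equiv> grph X"
abbreviation "M \<equiv> mor X"
abbreviation "T \<equiv> total_graph k \<Gamma> X"

section \<open>The system axioms in elementwise form\<close>

lemma grph: "v \<in> vertices \<Gamma> \<Longrightarrow> k_graph k (G v)"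
  using sys by (simp add: gamma_system_def)

lemma grph_ends:
  assumes "\<gamma> \<in> arr \<Gamma>"
  shows "k_graph k (G (rng \<Gamma> \<gamma>))" "k_graph k (G (src \<Gamma> \<gamma>))"
  using assms grph k_graph_arr(12,13)[OF base] by auto

lemma mor: "\<gamma> \<in> arr \<Gamma> \<Longrightarrow> k_morph (G (rng \<Gamma> \<gamma>)) (G (src \<Gamma> \<gamma>)) (M \<gamma>)"
  using sys by (simp add: gamma_system_def)

lemma mor_elts:
  assumes "\<gamma> \<in> arr \<Gamma>" "x \<in> elts (M \<gamma>)"
  shows "mrng (M \<gamma>) x \<in> vertices (G (rng \<Gamma> \<gamma>))" "msrc (M \<gamma>) x \<in> vertices (G (src \<Gamma> \<gamma>))"
  using k_morph_elts[OF mor] assms by auto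

text \<open>In the identity morph the pairs on which \<open>phi\<close> is meaningful are exactly
  the (r(a), a), which is why its value is recorded only there.\<close>

lemma mor_vertex:
  assumes "v \<in> vertices \<Gamma>"
  shows "elts (M v) = vertices (G v)"
    "x \<in> vertices (G v) \<Longrightarrow> mrng (M v) x = x" "x \<in> vertices (G v) \<Longrightarrow> msrc (M v) x = x"
    "a \<in> arr (G v) \<Longrightarrow> phi (M v) (rng (G v) a, a) = (a, src (G v) a)"
proof -
  have eq: "morph_eq (G v) (M v) (id_morph (G v))" using sys assms by (simp add: gamma_system_def)
  then show e: "elts (M v) = vertices (G v)" by (simp add: morph_eq_def id_morph_def)
  show r: "x \<in> vertices (G v) \<Longrightarrow> mrng (M v) x = x" "x \<in> vertices (G v) \<Longrightarrow> msrc (M v) x = x" for x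
    using eq e by (auto simp: morph_eq_def id_morph_def)
  assume a: "a \<in> arr (G v)"
  then have "(rng (G v) a, a) \<in> fibre_right (M v) (G v)"
    using e r k_graph_arr(12)[OF grph[OF assms]] by (auto simp: fibre_right_def)
  then show "phi (M v) (rng (G v) a, a) = (a, src (G v) a)"
    using eq by (auto simp: morph_eq_def id_morph_def)
qed

lemma theta_iso:
  assumes "\<alpha> \<in> arr \<Gamma>" "\<beta> \<in> arr \<Gamma>" "src \<Gamma> \<alpha> = rng \<Gamma> \<beta>"
  shows "morph_iso (G (src \<Gamma> \<beta>)) (comp_morph (M \<alpha>) (M \<beta>)) (M (cmp \<Gamma> \<alpha> \<beta>)) (theta X \<alpha> \<beta>)"
  using sys assms by (simp add: gamma_system_def)

lemma theta_elts:
  assumes "\<alpha> \<in> arr \<Gamma>" "\<beta> \<in> arr \<Gamma>" "src \<Gamma> \<alpha> = rng \<Gamma> \<beta>"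
    "x \<in> elts (M \<alpha>)" "y \<in> elts (M \<beta>)" "msrc (M \<alpha>) x = mrng (M \<beta>) y"
  shows "theta X \<alpha> \<beta> (x, y) \<in> elts (M (cmp \<Gamma> \<alpha> \<beta>))"
    "mrng (M (cmp \<Gamma> \<alpha> \<beta>)) (theta X \<alpha> \<beta> (x, y)) = mrng (M \<alpha>) x"
    "msrc (M (cmp \<Gamma> \<alpha> \<beta>)) (theta X \<alpha> \<beta> (x, y)) = msrc (M \<beta>) y"
proof -
  have p: "(x, y) \<in> elts (comp_morph (M \<alpha>) (M \<beta>))" using assms by (simp add: comp_morph_def)
  note t = theta_iso[OF assms(1-3), unfolded morph_iso_def]
  show "theta X \<alpha> \<beta> (x, y) \<in> elts (M (cmp \<Gamma> \<alpha> \<beta>))"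
    using t p by (auto simp: bij_betw_def)
  show "mrng (M (cmp \<Gamma> \<alpha> \<beta>)) (theta X \<alpha> \<beta> (x, y)) = mrng (M \<alpha>) x"
    "msrc (M (cmp \<Gamma> \<alpha> \<beta>)) (theta X \<alpha> \<beta> (x, y)) = msrc (M \<beta>) y"
    using t[THEN conjunct2, THEN conjunct1, THEN bspec, OF p] by (auto simp: comp_morph_def)
qed

text \<open>This is the intertwining condition of \<open>morph_iso\<close> with the
  \<open>phi\<close> of the composite morph carried out in its two moves, past \<open>y\<close> and
  then past \<open>x\<close>. It is the link between \<open>phi\<close> and \<open>theta\<close> on
  which associativity of the total graph depends.\<close>

lemma theta_phi:
  assumes "\<alpha> \<in> arr \<Gamma>" "\<beta> \<in> arr \<Gamma>" "src \<Gamma> \<alpha> = rng \<Gamma> \<beta>"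
    "x \<in> elts (M \<alpha>)" "y \<in> elts (M \<beta>)" "msrc (M \<alpha>) x = mrng (M \<beta>) y"
    "c \<in> arr (G (src \<Gamma> \<beta>))" "msrc (M \<beta>) y = rng (G (src \<Gamma> \<beta>)) c"
    "phi (M \<beta>) (y, c) = (b, y')" "phi (M \<alpha>) (x, b) = (a, x')"
  shows "phi (M (cmp \<Gamma> \<alpha> \<beta>)) (theta X \<alpha> \<beta> (x, y), c) = (a, theta X \<alpha> \<beta> (x', y'))"
proof -
  have "((x, y), c) \<in> fibre_right (comp_morph (M \<alpha>) (M \<beta>)) (G (src \<Gamma> \<beta>))"
    using assms by (simp add: comp_morph_def fibre_right_def)
  then have "map_prod id (theta X \<alpha> \<beta>) (phi (comp_morph (M \<alpha>) (M \<beta>)) ((x, y), c)) =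
      phi (M (cmp \<Gamma> \<alpha> \<beta>)) (map_prod (theta X \<alpha> \<beta>) id ((x, y), c))"
    using theta_iso[OF assms(1-3), unfolded morph_iso_def] by blast
  then show ?thesis using assms(9,10) by (simp add: comp_morph_def)
qed

lemma theta_inj:
  assumes "\<alpha> \<in> arr \<Gamma>" "\<beta> \<in> arr \<Gamma>" "src \<Gamma> \<alpha> = rng \<Gamma> \<beta>"
    "x \<in> elts (M \<alpha>)" "y \<in> elts (M \<beta>)" "msrc (M \<alpha>) x = mrng (M \<beta>) y"
    "x' \<in> elts (M \<alpha>)" "y' \<in> elts (M \<beta>)" "msrc (M \<alpha>) x' = mrng (M \<beta>) y'"
    "theta X \<alpha> \<beta> (x, y) = theta X \<alpha> \<beta> (x', y')"
  shows "x = x' \<and> y = y'"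
proof -
  have "inj_on (theta X \<alpha> \<beta>) (elts (comp_morph (M \<alpha>) (M \<beta>)))"
    using theta_iso[OF assms(1-3)] by (simp add: morph_iso_def bij_betw_def)
  from inj_onD[OF this assms(10)] show ?thesis using assms by (simp add: comp_morph_def)
qed

lemma theta_surj:
  assumes "\<alpha> \<in> arr \<Gamma>" "\<beta> \<in> arr \<Gamma>" "src \<Gamma> \<alpha> = rng \<Gamma> \<beta>" "z \<in> elts (M (cmp \<Gamma> \<alpha> \<beta>))"
  obtains x y where "x \<in> elts (M \<alpha>)" "y \<in> elts (M \<beta>)" "msrc (M \<alpha>) x = mrng (M \<beta>) y"
    "z = theta X \<alpha> \<beta> (x, y)"
proof -
  have "z \<in> theta X \<alpha> \<beta> ` elts (comp_morph (M \<alpha>) (M \<beta>))"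
    using theta_iso[OF assms(1-3)] assms(4) by (simp add: morph_iso_def bij_betw_def)
  then show thesis using that by (auto simp: comp_morph_def)
qed

lemma theta_unit:
  assumes "\<gamma> \<in> arr \<Gamma>" "x \<in> elts (M \<gamma>)"
  shows "theta X (rng \<Gamma> \<gamma>) \<gamma> (mrng (M \<gamma>) x, x) = x" "theta X \<gamma> (src \<Gamma> \<gamma>) (x, msrc (M \<gamma>) x) = x"
  using sys assms by (auto simp: gamma_system_def)

lemma theta_assoc:
  assumes "\<alpha> \<in> arr \<Gamma>" "\<beta> \<in> arr \<Gamma>" "\<gamma> \<in> arr \<Gamma>" "src \<Gamma> \<alpha> = rng \<Gamma> \<beta>" "src \<Gamma> \<beta> = rng \<Gamma> \<gamma>"
    "x \<in> elts (M \<alpha>)" "y \<in> elts (M \<beta>)" "z \<in> elts (M \<gamma>)"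
    "msrc (M \<alpha>) x = mrng (M \<beta>) y" "msrc (M \<beta>) y = mrng (M \<gamma>) z"
  shows "theta X (cmp \<Gamma> \<alpha> \<beta>) \<gamma> (theta X \<alpha> \<beta> (x, y), z) =
    theta X \<alpha> (cmp \<Gamma> \<beta> \<gamma>) (x, theta X \<beta> \<gamma> (y, z))"
  using sys assms unfolding gamma_system_def by blast

section \<open>The total graph as a (k + l)-graph\<close>

lemma total_arr [simp]:
  "(\<gamma>, a, x) \<in> arr T \<longleftrightarrow> \<gamma> \<in> arr \<Gamma> \<and> a \<in> arr (G (rng \<Gamma> \<gamma>)) \<and> x \<in> elts (M \<gamma>) \<and>
     src (G (rng \<Gamma> \<gamma>)) a = mrng (M \<gamma>) x"
  by (simp add: total_graph_def)

lemma total_rng [simp]: "rng T (\<gamma>, a, x) = (rng \<Gamma> \<gamma>, rng (G (rng \<Gamma> \<gamma>)) a, rng (G (rng \<Gamma> \<gamma>)) a)"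
  by (simp add: total_graph_def Let_def)

lemma total_src [simp]: "src T (\<gamma>, a, x) = (src \<Gamma> \<gamma>, msrc (M \<gamma>) x, msrc (M \<gamma>) x)"
  by (simp add: total_graph_def Let_def)

lemma total_deg [simp]: "deg T (\<gamma>, a, x) = join_coords k (deg (G (rng \<Gamma> \<gamma>)) a) (deg \<Gamma> \<gamma>)"
  by (simp add: total_graph_def)

lemma total_cmp:
  "phi (M \<gamma>) (x, b) = (b', x') \<Longrightarrow>
     cmp T (\<gamma>, a, x) (\<delta>, b, y) = (cmp \<Gamma> \<gamma> \<delta>, cmp (G (rng \<Gamma> \<gamma>)) a b', theta X \<gamma> \<delta> (x', y))"
  by (simp add: total_graph_def)

lemma total_cmpE:
  assumes "(\<gamma>, a, x) \<in> arr T" "(\<delta>, b, y) \<in> arr T" "src T (\<gamma>, a, x) = rng T (\<delta>, b, y)"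
  obtains b' x' where "phi (M \<gamma>) (x, b) = (b', x')" "b' \<in> arr (G (rng \<Gamma> \<gamma>))" "x' \<in> elts (M \<gamma>)"
    "src (G (rng \<Gamma> \<gamma>)) b' = mrng (M \<gamma>) x'" "deg (G (rng \<Gamma> \<gamma>)) b' = deg (G (rng \<Gamma> \<delta>)) b"
    "msrc (M \<gamma>) x' = mrng (M \<delta>) y" "rng (G (rng \<Gamma> \<gamma>)) b' = mrng (M \<gamma>) x"
    "cmp T (\<gamma>, a, x) (\<delta>, b, y) = (cmp \<Gamma> \<gamma> \<delta>, cmp (G (rng \<Gamma> \<gamma>)) a b', theta X \<gamma> \<delta> (x', y))"
proof -
  have \<gamma>: "\<gamma> \<in> arr \<Gamma>" and s: "src \<Gamma> \<gamma> = rng \<Gamma> \<delta>" and x: "x \<in> elts (M \<gamma>)"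
    and b: "b \<in> arr (G (src \<Gamma> \<gamma>))" "msrc (M \<gamma>) x = rng (G (src \<Gamma> \<gamma>)) b"
    and y: "src (G (rng \<Gamma> \<delta>)) b = mrng (M \<delta>) y"
    using assms by auto
  show thesis
    by (rule k_morph_phi[OF mor[OF \<gamma>] x b], rule that) (use s y total_cmp in auto)
qed

lemma total_vertex:
  assumes "v \<in> vertices \<Gamma>" "w \<in> vertices (G v)"
  shows "(v, w, w) \<in> arr T" "rng T (v, w, w) = (v, w, w)" "src T (v, w, w) = (v, w, w)"
    "deg T (v, w, w) = 0"
  using assms vertex_arr[OF base assms(1)] vertex_arr[OF grph[OF assms(1)] assms(2)] mor_vertex[OF assms(1)]
  by auto

lemma total_ends:
  assumes "(\<gamma>, a, x) \<in> arr T"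
  shows "rng \<Gamma> \<gamma> \<in> vertices \<Gamma>" "rng (G (rng \<Gamma> \<gamma>)) a \<in> vertices (G (rng \<Gamma> \<gamma>))"
    "src \<Gamma> \<gamma> \<in> vertices \<Gamma>" "msrc (M \<gamma>) x \<in> vertices (G (src \<Gamma> \<gamma>))"
  using assms k_graph_arr[OF base] k_graph_arr[OF grph_ends(1)] mor_elts by auto

text \<open>Degrees add because \<open>b\<close> keeps its degree when it is moved past
  \<open>x\<close>. The range survives because \<open>b'\<close> is absorbed to the right of
  \<open>a\<close>, the source because \<open>theta\<close> preserves the source of
  \<open>y\<close>.\<close>

lemma total_cmp_arr:
  assumes "p \<in> arr T" "q \<in> arr T" "src T p = rng T q"
  shows "cmp T p q \<in> arr T" "rng T (cmp T p q) = rng T p" "src T (cmp T p q) = src T q"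
    "deg T (cmp T p q) = deg T p + deg T q"
proof -
  obtain \<gamma> a x \<delta> b y where pq: "p = (\<gamma>, a, x)" "q = (\<delta>, b, y)" by (metis prod_cases3)
  obtain b' x' where *: "phi (M \<gamma>) (x, b) = (b', x')" "b' \<in> arr (G (rng \<Gamma> \<gamma>))" "x' \<in> elts (M \<gamma>)"
    "src (G (rng \<Gamma> \<gamma>)) b' = mrng (M \<gamma>) x'" "deg (G (rng \<Gamma> \<gamma>)) b' = deg (G (rng \<Gamma> \<delta>)) b"
    "msrc (M \<gamma>) x' = mrng (M \<delta>) y" "rng (G (rng \<Gamma> \<gamma>)) b' = mrng (M \<gamma>) x"
    "cmp T p q = (cmp \<Gamma> \<gamma> \<delta>, cmp (G (rng \<Gamma> \<gamma>)) a b', theta X \<gamma> \<delta> (x', y))"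
    using assms unfolding pq by (rule total_cmpE)
  have \<gamma>: "\<gamma> \<in> arr \<Gamma>" "\<delta> \<in> arr \<Gamma>" "src \<Gamma> \<gamma> = rng \<Gamma> \<delta>" and y: "y \<in> elts (M \<delta>)"
    and a: "a \<in> arr (G (rng \<Gamma> \<gamma>))" "src (G (rng \<Gamma> \<gamma>)) a = rng (G (rng \<Gamma> \<gamma>)) b'"
    using assms * unfolding pq by auto
  note facts = * k_graph_cmp[OF base \<gamma>] theta_elts[OF \<gamma> *(3) y *(6)]
    k_graph_cmp[OF grph_ends(1)[OF \<gamma>(1)] a(1) *(2) a(2)]
  show "cmp T p q \<in> arr T" "rng T (cmp T p q) = rng T p" "src T (cmp T p q) = src T q"
    "deg T (cmp T p q) = deg T p + deg T q"
    using facts assms unfolding pq by (auto simp: join_coords_add)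
qed

lemma total_unit:
  assumes "p \<in> arr T"
  shows "cmp T (rng T p) p = p" "cmp T p (src T p) = p"
proof -
  obtain \<gamma> a x where p: "p = (\<gamma>, a, x)" by (metis prod_cases3)
  have \<gamma>: "\<gamma> \<in> arr \<Gamma>" and x: "x \<in> elts (M \<gamma>)" and a: "a \<in> arr (G (rng \<Gamma> \<gamma>))"
    "src (G (rng \<Gamma> \<gamma>)) a = mrng (M \<gamma>) x" using assms p by auto
  note g = k_graph_arr[OF base \<gamma>] and ga = k_graph_arr[OF grph_ends(1)[OF \<gamma>] a(1)]
  \<comment> \<open>Here \<open>a\<close> is moved past its own range vertex inside the identity
    morph, which leaves \<open>src a\<close>, that is r(x), to be absorbed by
    \<open>theta\<close>.\<close>
  show "cmp T (rng T p) p = p"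
    using total_cmp[OF mor_vertex(4)[OF g(12) a(1)]] theta_unit[OF \<gamma> x] g ga a(2)
    by (simp add: p)
  \<comment> \<open>Here the vertex s(x) is moved past \<open>x\<close> in a general morph, so
    \<open>k_morph_phi_vertex\<close> is required.\<close>
  show "cmp T p (src T p) = p"
    using total_cmp[OF k_morph_phi_vertex[OF grph_ends[OF \<gamma>] mor[OF \<gamma>] x]]
      theta_unit[OF \<gamma> x] g ga a(2)
    by (simp add: p)
qed

text \<open>In the product a x b y c z both bracketings bring \<open>c\<close> to the left past
  \<open>y\<close>, giving c', and then past x', giving c''. They differ only in when
  \<open>b\<close> and \<open>c\<close> are multiplied and when the morph elements are
  merged.\<close>

lemma total_assoc:
  assumes "p \<in> arr T" "q \<in> arr T" "t \<in> arr T" "src T p = rng T q" "src T q = rng T t"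
  shows "cmp T (cmp T p q) t = cmp T p (cmp T q t)"
proof -
  obtain \<gamma> a x \<delta> b y \<epsilon> c z where pqt: "p = (\<gamma>, a, x)" "q = (\<delta>, b, y)" "t = (\<epsilon>, c, z)"
    by (metis prod_cases3)
  obtain b' x' where pq: "phi (M \<gamma>) (x, b) = (b', x')" "b' \<in> arr (G (rng \<Gamma> \<gamma>))" "x' \<in> elts (M \<gamma>)"
    "src (G (rng \<Gamma> \<gamma>)) b' = mrng (M \<gamma>) x'" "msrc (M \<gamma>) x' = mrng (M \<delta>) y"
    "rng (G (rng \<Gamma> \<gamma>)) b' = mrng (M \<gamma>) x"
    "cmp T p q = (cmp \<Gamma> \<gamma> \<delta>, cmp (G (rng \<Gamma> \<gamma>)) a b', theta X \<gamma> \<delta> (x', y))"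
    using assms(1,2,4) total_cmpE unfolding pqt by metis
  obtain c' y' where qt: "phi (M \<delta>) (y, c) = (c', y')" "c' \<in> arr (G (rng \<Gamma> \<delta>))" "y' \<in> elts (M \<delta>)"
    "src (G (rng \<Gamma> \<delta>)) c' = mrng (M \<delta>) y'" "msrc (M \<delta>) y' = mrng (M \<epsilon>) z"
    "rng (G (rng \<Gamma> \<delta>)) c' = mrng (M \<delta>) y"
    "cmp T q t = (cmp \<Gamma> \<delta> \<epsilon>, cmp (G (rng \<Gamma> \<delta>)) b c', theta X \<delta> \<epsilon> (y', z))"
    using assms(2,3,5) total_cmpE unfolding pqt by metis
  have \<gamma>: "\<gamma> \<in> arr \<Gamma>" "\<delta> \<in> arr \<Gamma>" "\<epsilon> \<in> arr \<Gamma>" "src \<Gamma> \<gamma> = rng \<Gamma> \<delta>" "src \<Gamma> \<delta> = rng \<Gamma> \<epsilon>"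
    and e: "x \<in> elts (M \<gamma>)" "y \<in> elts (M \<delta>)" "z \<in> elts (M \<epsilon>)"
    and a: "a \<in> arr (G (rng \<Gamma> \<gamma>))" "src (G (rng \<Gamma> \<gamma>)) a = mrng (M \<gamma>) x"
    and b: "b \<in> arr (G (rng \<Gamma> \<delta>))" "rng (G (rng \<Gamma> \<delta>)) b = msrc (M \<gamma>) x"
      "src (G (rng \<Gamma> \<delta>)) b = mrng (M \<delta>) y"
    and c: "c \<in> arr (G (rng \<Gamma> \<epsilon>))" "rng (G (rng \<Gamma> \<epsilon>)) c = msrc (M \<delta>) y"
    using assms unfolding pqt by auto
  note m = mor[OF \<gamma>(1)]
  have c': "c' \<in> arr (G (src \<Gamma> \<gamma>))" "msrc (M \<gamma>) x' = rng (G (src \<Gamma> \<gamma>)) c'"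
    using qt pq \<gamma> by auto
  obtain c'' x'' where c'': "phi (M \<gamma>) (x', c') = (c'', x'')" "c'' \<in> arr (G (rng \<Gamma> \<gamma>))"
    "x'' \<in> elts (M \<gamma>)" "src (G (src \<Gamma> \<gamma>)) c' = msrc (M \<gamma>) x''"
    "rng (G (rng \<Gamma> \<gamma>)) c'' = mrng (M \<gamma>) x'"
    using k_morph_phi[OF m pq(3) c'] by metis
  \<comment> \<open>Left bracketing: x' and \<open>y\<close> are already merged, and
    \<open>theta_phi\<close> replaces the single move past the merged element by the two successive
    moves.\<close>
  have "phi (M (cmp \<Gamma> \<gamma> \<delta>)) (theta X \<gamma> \<delta> (x', y), c) = (c'', theta X \<gamma> \<delta> (x'', y'))"
    using theta_phi[OF \<gamma>(1,2,4) pq(3) e(2) pq(5) _ _ qt(1) c''(1)] \<gamma> c by simp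
  then have "cmp T (cmp T p q) t = (cmp \<Gamma> (cmp \<Gamma> \<gamma> \<delta>) \<epsilon>,
      cmp (G (rng \<Gamma> \<gamma>)) (cmp (G (rng \<Gamma> \<gamma>)) a b') c'',
      theta X (cmp \<Gamma> \<gamma> \<delta>) \<epsilon> (theta X \<gamma> \<delta> (x'', y'), z))"
    using total_cmp k_graph_cmp(2)[OF base \<gamma>(1,2,4)] unfolding pq(7) pqt(3) by simp
  \<comment> \<open>Right bracketing: \<open>b\<close> and c' are already multiplied, and
    multiplicativity of \<open>phi\<close> moves them past \<open>x\<close> one after the
    other.\<close>
  moreover have "phi (M \<gamma>) (x, cmp (G (rng \<Gamma> \<delta>)) b c') = (cmp (G (rng \<Gamma> \<gamma>)) b' c'', x'')"
    using k_morph_phi_cmp[OF m e(1) _ _ c'(1) _ pq(1) c''(1)] b \<gamma>(4) qt(6) by simp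
  then have "cmp T p (cmp T q t) = (cmp \<Gamma> \<gamma> (cmp \<Gamma> \<delta> \<epsilon>),
      cmp (G (rng \<Gamma> \<gamma>)) a (cmp (G (rng \<Gamma> \<gamma>)) b' c''),
      theta X \<gamma> (cmp \<Gamma> \<delta> \<epsilon>) (x'', theta X \<delta> \<epsilon> (y', z)))"
    using total_cmp unfolding qt(7) pqt(1) by simp
  ultimately show ?thesis
    using k_graph_assoc[OF base \<gamma>] k_graph_assoc[OF grph_ends(1)[OF \<gamma>(1)] a(1) pq(2) c''(2)]
      theta_assoc[OF \<gamma> c''(3) qt(3) e(3) _ qt(5)] a pq c'' qt \<gamma>(4) by simp
qed

lemma total_ends_arr:
  assumes "p \<in> arr T"
  shows "rng T p \<in> arr T" "src T p \<in> arr T"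
    "rng T (rng T p) = rng T p" "src T (rng T p) = rng T p"
    "rng T (src T p) = src T p" "src T (src T p) = src T p"
    "deg T (rng T p) = 0" "deg T (src T p) = 0"
proof -
  obtain \<gamma> a x where p: "p = (\<gamma>, a, x)" by (metis prod_cases3)
  note e = total_ends[OF assms[unfolded p]]
  show "rng T p \<in> arr T" "src T p \<in> arr T"
    "rng T (rng T p) = rng T p" "src T (rng T p) = rng T p"
    "rng T (src T p) = src T p" "src T (src T p) = src T p"
    "deg T (rng T p) = 0" "deg T (src T p) = 0"
    using total_vertex[OF e(1,2)] total_vertex[OF e(3,4)]
    by (simp_all only: p total_rng[of \<gamma> a x] total_src[of \<gamma> a x])
qed

lemma total_category: "small_category T"
  unfolding small_category_def
  by (intro conjI ballI impI) (auto simp only: total_ends_arr total_cmp_arr total_unit total_assoc)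

lemma total_degree: "degree_functor (k + l) T"
proof -
  have "deg T p \<in> natk (k + l)" if "p \<in> arr T" for p
  proof -
    obtain \<gamma> a x where p: "p = (\<gamma>, a, x)" by (metis prod_cases3)
    then have "\<gamma> \<in> arr \<Gamma>" using that by simp
    from join_coords_natk[OF k_graph_arr(9)[OF base this]] show ?thesis by (simp add: p)
  qed
  then show ?thesis
    unfolding degree_functor_def using total_cmp_arr(4) total_ends_arr(7,8) by simp
qed

text \<open>Cutting base arrow, graph arrow and morph element separately turns ax into a1 a2 x1 x2.
  Surjectivity of \<open>phi\<close> rewrites the inner pair a2 x1 as u b, and (a1 u)(b x2) is the
  required factorisation; \<open>b\<close> has the degree of \<open>a2\<close>, so the degrees come
  out right.\<close>

lemma total_factor_ex:
  assumes "p \<in> arr T" "m \<in> natk (k + l)" "n \<in> natk (k + l)" "deg T p = m + n"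
  shows "\<exists>q t. q \<in> arr T \<and> t \<in> arr T \<and> deg T q = m \<and> deg T t = n \<and> src T q = rng T t \<and> p = cmp T q t"
proof -
  obtain \<gamma> a x where p: "p = (\<gamma>, a, x)" by (metis prod_cases3)
  have \<gamma>: "\<gamma> \<in> arr \<Gamma>" and x: "x \<in> elts (M \<gamma>)" and a: "a \<in> arr (G (rng \<Gamma> \<gamma>))"
    "src (G (rng \<Gamma> \<gamma>)) a = mrng (M \<gamma>) x" using assms p by auto
  have d: "join_coords k (deg (G (rng \<Gamma> \<gamma>)) a) (deg \<Gamma> \<gamma>) = m + n" using assms(4) p by simp
  have "deg \<Gamma> \<gamma> = last_coords k m + last_coords k n"
    using arg_cong[OF d, of "last_coords k"] by (simp add: last_coords_add)
  then obtain \<alpha> \<beta> where \<alpha>: "\<alpha> \<in> arr \<Gamma>" "\<beta> \<in> arr \<Gamma>" "deg \<Gamma> \<alpha> = last_coords k m"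
    "deg \<Gamma> \<beta> = last_coords k n" "src \<Gamma> \<alpha> = rng \<Gamma> \<beta>" "\<gamma> = cmp \<Gamma> \<alpha> \<beta>"
    using k_graph_factor[OF base \<gamma> last_coords_natk[OF assms(2)] last_coords_natk[OF assms(3)]] by metis
  note r = k_graph_cmp(2)[OF base \<alpha>(1,2,5), folded \<alpha>(6)]
  note GA = grph_ends(1)[OF \<alpha>(1)]
  have "deg (G (rng \<Gamma> \<alpha>)) a = first_coords k m + first_coords k n"
    using arg_cong[OF d, of "first_coords k"] k_graph_arr(9)[OF GA] a r
    by (simp add: first_coords_add)
  then obtain a1 a2 where a': "a1 \<in> arr (G (rng \<Gamma> \<alpha>))" "a2 \<in> arr (G (rng \<Gamma> \<alpha>))"
    "deg (G (rng \<Gamma> \<alpha>)) a1 = first_coords k m" "deg (G (rng \<Gamma> \<alpha>)) a2 = first_coords k n"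
    "src (G (rng \<Gamma> \<alpha>)) a1 = rng (G (rng \<Gamma> \<alpha>)) a2" "a = cmp (G (rng \<Gamma> \<alpha>)) a1 a2"
    using k_graph_factor[OF GA _ first_coords_natk first_coords_natk, of a] a r by metis
  obtain x1 x2 where x': "x1 \<in> elts (M \<alpha>)" "x2 \<in> elts (M \<beta>)" "msrc (M \<alpha>) x1 = mrng (M \<beta>) x2"
    "x = theta X \<alpha> \<beta> (x1, x2)"
    using theta_surj[OF \<alpha>(1,2,5)] x \<alpha>(6) by metis
  \<comment> \<open>The inner pair is composable because \<open>theta\<close> keeps the range of
    \<open>x1\<close> and composition keeps the source of \<open>a2\<close>. Hence it lies in the
    codomain of the bijection \<open>phi\<close>.\<close>
  have "src (G (rng \<Gamma> \<alpha>)) a2 = mrng (M \<alpha>) x1"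
    using a(2) r \<alpha>(6) x' a' theta_elts(2)[OF \<alpha>(1,2,5) x'(1-3)] k_graph_cmp(3)[OF GA a'(1,2,5)] by simp
  then obtain u b where u: "u \<in> elts (M \<alpha>)" "b \<in> arr (G (src \<Gamma> \<alpha>))"
    "msrc (M \<alpha>) u = rng (G (src \<Gamma> \<alpha>)) b" "phi (M \<alpha>) (u, b) = (a2, x1)"
    using k_morph_phi_surj[OF mor[OF \<alpha>(1)] a'(2) x'(1)] by metis
  have u': "src (G (src \<Gamma> \<alpha>)) b = msrc (M \<alpha>) x1" "rng (G (rng \<Gamma> \<alpha>)) a2 = mrng (M \<alpha>) u"
    "deg (G (src \<Gamma> \<alpha>)) b = first_coords k n"
    using k_morph_phi[OF mor[OF \<alpha>(1)] u(1-3)] u(4) a'(4) by (metis Pair_inject)+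
  let ?q = "(\<alpha>, a1, u)" and ?t = "(\<beta>, b, x2)"
  have "?q \<in> arr T" "?t \<in> arr T" "deg T ?q = m" "deg T ?t = n" "src T ?q = rng T ?t"
    using \<alpha> a' x' u u' by auto
  moreover have "p = cmp T ?q ?t" using total_cmp[OF u(4)] \<alpha>(6) a'(6) x'(4) p by simp
  ultimately show ?thesis by blast
qed

text \<open>The multiplication is undone layer by layer. Unique factorisation in the base comes
  first, since only then do the remaining data lie in the same graphs and morphs. Factorisation in
  the graph over r(\<alpha>) and injectivity of \<open>theta\<close> then determine the moved pair
  (c, u), and injectivity of \<open>phi\<close> recovers (x, b) from it.\<close>

lemma total_factor_unique:
  assumes q: "q \<in> arr T" "t \<in> arr T" "src T q = rng T t"
    and q': "q' \<in> arr T" "t' \<in> arr T" "src T q' = rng T t'"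
    and eq: "deg T q = deg T q'" "deg T t = deg T t'" "cmp T q t = cmp T q' t'"
  shows "q = q' \<and> t = t'"
proof -
  obtain \<alpha> a x \<beta> b y where qt: "q = (\<alpha>, a, x)" "t = (\<beta>, b, y)" by (metis prod_cases3)
  obtain \<alpha>' a' x' \<beta>' b' y' where qt': "q' = (\<alpha>', a', x')" "t' = (\<beta>', b', y')" by (metis prod_cases3)
  obtain c u where c: "phi (M \<alpha>) (x, b) = (c, u)" "c \<in> arr (G (rng \<Gamma> \<alpha>))" "u \<in> elts (M \<alpha>)"
    "deg (G (rng \<Gamma> \<alpha>)) c = deg (G (rng \<Gamma> \<beta>)) b"
    "msrc (M \<alpha>) u = mrng (M \<beta>) y" "rng (G (rng \<Gamma> \<alpha>)) c = mrng (M \<alpha>) x"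
    "cmp T q t = (cmp \<Gamma> \<alpha> \<beta>, cmp (G (rng \<Gamma> \<alpha>)) a c, theta X \<alpha> \<beta> (u, y))"
    using q total_cmpE unfolding qt by metis
  obtain c' u' where c': "phi (M \<alpha>') (x', b') = (c', u')" "c' \<in> arr (G (rng \<Gamma> \<alpha>'))" "u' \<in> elts (M \<alpha>')"
    "deg (G (rng \<Gamma> \<alpha>')) c' = deg (G (rng \<Gamma> \<beta>')) b'"
    "msrc (M \<alpha>') u' = mrng (M \<beta>') y'" "rng (G (rng \<Gamma> \<alpha>')) c' = mrng (M \<alpha>') x'"
    "cmp T q' t' = (cmp \<Gamma> \<alpha>' \<beta>', cmp (G (rng \<Gamma> \<alpha>')) a' c', theta X \<alpha>' \<beta>' (u', y'))"
    using q' total_cmpE unfolding qt' by metis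
  have g: "\<alpha> \<in> arr \<Gamma>" "\<beta> \<in> arr \<Gamma>" "src \<Gamma> \<alpha> = rng \<Gamma> \<beta>" and g': "\<alpha>' \<in> arr \<Gamma>" "\<beta>' \<in> arr \<Gamma>" "src \<Gamma> \<alpha>' = rng \<Gamma> \<beta>'"
    using q q' qt qt' by auto
  have "deg \<Gamma> \<alpha> = deg \<Gamma> \<alpha>'" "deg \<Gamma> \<beta> = deg \<Gamma> \<beta>'"
    using arg_cong[OF eq(1), of "last_coords k"] arg_cong[OF eq(2), of "last_coords k"] qt qt' by auto
  then have [simp]: "\<alpha>' = \<alpha>" "\<beta>' = \<beta>"
    using k_graph_factor_unique[OF base g(1,2) g'(1,2) g(3) g'(3)] eq(3) c(7) c'(7) by auto
  note GA = grph_ends(1)[OF g(1)]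
  have a: "a \<in> arr (G (rng \<Gamma> \<alpha>))" "a' \<in> arr (G (rng \<Gamma> \<alpha>))"
    "src (G (rng \<Gamma> \<alpha>)) a = rng (G (rng \<Gamma> \<alpha>)) c" "src (G (rng \<Gamma> \<alpha>)) a' = rng (G (rng \<Gamma> \<alpha>)) c'"
    and b: "b \<in> arr (G (rng \<Gamma> \<beta>))" "b' \<in> arr (G (rng \<Gamma> \<beta>))"
    and e: "y \<in> elts (M \<beta>)" "y' \<in> elts (M \<beta>)" "x \<in> elts (M \<alpha>)" "x' \<in> elts (M \<alpha>)"
    and s: "msrc (M \<alpha>) x = rng (G (rng \<Gamma> \<beta>)) b" "msrc (M \<alpha>) x' = rng (G (rng \<Gamma> \<beta>)) b'"
    using q q' c c' qt qt' by auto
  note GB = grph_ends(1)[OF g(2)]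
  \<comment> \<open>The hypotheses give the degree of \<open>b\<close>, whereas the factorisation of
    the graph component involves \<open>c\<close>; the two degrees agree because \<open>phi\<close>
    preserves degree.\<close>
  have "deg (G (rng \<Gamma> \<alpha>)) a = deg (G (rng \<Gamma> \<alpha>)) a'" "deg (G (rng \<Gamma> \<beta>)) b = deg (G (rng \<Gamma> \<beta>)) b'"
    using arg_cong[OF eq(1), of "first_coords k"] arg_cong[OF eq(2), of "first_coords k"] qt qt'
      k_graph_arr(9)[OF GA] k_graph_arr(9)[OF GB] a b by auto
  then have ac: "a = a' \<and> c = c'"
    using k_graph_factor_unique[OF GA a(1) c(2) a(2)] c c' a eq(3) by auto
  have uy: "u = u' \<and> y = y'"
    using theta_inj[OF g c(3) e(1) c(5)] c' e eq(3) c(7) by auto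
  have "x = x' \<and> b = b'"
    using k_morph_phi_inj[OF mor[OF g(1)] e(3) _ _ e(4)] ac uy c(1) c'(1) b s g(3) by auto
  then show ?thesis using ac uy qt qt' by simp
qed

lemma total_countable: "countable (arr T)"
proof (rule countable_subset)
  show "arr T \<subseteq> (SIGMA \<gamma>:arr \<Gamma>. arr (G (rng \<Gamma> \<gamma>)) \<times> elts (M \<gamma>))" by (auto simp: total_graph_def)
  show "countable (SIGMA \<gamma>:arr \<Gamma>. arr (G (rng \<Gamma> \<gamma>)) \<times> elts (M \<gamma>))"
    using base grph_ends mor by (intro countable_SIGMA) (auto simp: k_graph_def k_morph_def)
qed

theorem total_k_graph: "k_graph (k + l) T"
  unfolding k_graph_def
proof (intro conjI total_countable total_category total_degree)
  obtain v where v: "v \<in> vertices \<Gamma>" using vertices_nonempty[OF base] .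
  obtain w where "w \<in> vertices (G v)" using vertices_nonempty[OF grph[OF v]] .
  then show "arr T \<noteq> {}" using total_vertex(1)[OF v] by blast
  show "factorisation_property (k + l) T"
    unfolding factorisation_property_def
  proof (intro ballI impI)
    fix p m n assume "p \<in> arr T" "m \<in> natk (k + l)" "n \<in> natk (k + l)" "deg T p = m + n"
    from total_factor_ex[OF this] obtain q t where qt:
      "q \<in> arr T \<and> t \<in> arr T \<and> deg T q = m \<and> deg T t = n \<and> src T q = rng T t \<and> p = cmp T q t" by blast
    then show "\<exists>!(q, t). q \<in> arr T \<and> t \<in> arr T \<and> deg T q = m \<and> deg T t = n \<and> src T q = rng T t \<and>
        p = cmp T q t"
    proof (intro ex1I[of _ "(q, t)"])
      fix z
      assume "case z of (q, t) \<Rightarrow> q \<in> arr T \<and> t \<in> arr T \<and> deg T q = m \<and> deg T t = n \<and>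
        src T q = rng T t \<and> p = cmp T q t"
      then show "z = (q, t)"
        using qt total_factor_unique[of "fst z" "snd z" q t] by (cases z) simp
    qed simp
  qed
qed

lemma total_proj: "quasimorphism (last_coords k) T \<Gamma> fst"
  unfolding quasimorphism_def
proof (intro conjI ballI impI)
  fix p q assume "p \<in> arr T" "q \<in> arr T" "src T p = rng T q"
  then show "fst (cmp T p q) = cmp \<Gamma> (fst p) (fst q)"
    by (auto simp: total_graph_def Let_def split: prod.splits)
qed (auto simp: total_graph_def Let_def)

section \<open>The system induced by the total graph\<close>

sublocale total: graph_over k l \<Gamma> T fst
  by unfold_locales (use base total_k_graph total_proj in auto)

text \<open>Over a vertex the third entry is itself a vertex of \<open>G v\<close>, and
  composability with \<open>a\<close> forces it to be the source of \<open>a\<close>.\<close>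

lemma total_fibre_arr:
  assumes v: "v \<in> vertices \<Gamma>"
  shows "p \<in> arr T \<and> fst p = v \<longleftrightarrow> (\<exists>a\<in>arr (G v). p = (v, a, src (G v) a))"
  using vertex_arr[OF base v] mor_vertex[OF v] k_graph_arr(13)[OF grph[OF v]]
  by (cases p) auto

text \<open>Degree (0, d(\<gamma>)) forces \<open>a\<close> to be a vertex, and composability then
  leaves only r(x).\<close>

lemma total_elts:
  assumes \<gamma>: "\<gamma> \<in> arr \<Gamma>"
  shows "total.E \<gamma> = (\<lambda>x. (\<gamma>, mrng (M \<gamma>) x, x)) ` elts (M \<gamma>)"
proof (intro equalityI subsetI)
  note g = grph_ends(1)[OF \<gamma>]
  fix p assume p: "p \<in> total.E \<gamma>"
  then obtain a x where ax: "p = (\<gamma>, a, x)" by (cases p) (auto simp: bundle_elts_def)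
  have *: "x \<in> elts (M \<gamma>)" "a \<in> arr (G (rng \<Gamma> \<gamma>))" "src (G (rng \<Gamma> \<gamma>)) a = mrng (M \<gamma>) x"
    "join_coords k (deg (G (rng \<Gamma> \<gamma>)) a) (deg \<Gamma> \<gamma>) = join_coords k 0 (deg \<Gamma> \<gamma>)"
    using p by (auto simp: bundle_elts_def ax)
  have "a \<in> vertices (G (rng \<Gamma> \<gamma>))"
    using arg_cong[OF *(4), of "first_coords k"] k_graph_arr(9)[OF g *(2)] *(2)
    by (simp add: vertices_def)
  then have "a = mrng (M \<gamma>) x" using vertex_arr(3)[OF g] *(3) by simp
  then show "p \<in> (\<lambda>x. (\<gamma>, mrng (M \<gamma>) x, x)) ` elts (M \<gamma>)" using *(1) ax by simp
next
  fix p assume "p \<in> (\<lambda>x. (\<gamma>, mrng (M \<gamma>) x, x)) ` elts (M \<gamma>)"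
  then show "p \<in> total.E \<gamma>"
    using \<gamma> vertex_arr[OF grph_ends(1)[OF \<gamma>] mor_elts(1)[OF \<gamma>]]
    by (auto simp: bundle_elts_def)
qed

lemma total_fibre_iso:
  assumes v: "v \<in> vertices \<Gamma>"
  shows "graph_iso (bundle_fibre k T fst v) (G v) (\<lambda>p. fst (snd p))"
proof -
  let ?F = "bundle_fibre k T fst v" and ?h = "\<lambda>p :: 'g \<times> 'a \<times> 'a. fst (snd p)"
  have F: "p \<in> arr ?F \<longleftrightarrow> (\<exists>a\<in>arr (G v). p = (v, a, src (G v) a))" for p
    using total_fibre_arr[OF v] by (simp add: bundle_fibre_def)
  have F_ops: "rng ?F = rng T" "src ?F = src T" "cmp ?F = cmp T" "deg ?F p = first_coords k (deg T p)" for p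
    by (simp_all add: bundle_fibre_def)
  note vv = vertex_arr[OF base v] and G = k_graph_arr[OF grph[OF v]]
  have "quasimorphism id ?F (G v) ?h"
    unfolding quasimorphism_def
  proof (intro conjI ballI impI)
    fix p q assume pq: "p \<in> arr ?F" "q \<in> arr ?F" "src ?F p = rng ?F q"
    then obtain a b where "a \<in> arr (G v)" "p = (v, a, src (G v) a)" "b \<in> arr (G v)" "q = (v, b, src (G v) b)"
      using F by metis
    moreover from this have "src (G v) a = rng (G v) b"
      using pq(3) vv mor_vertex(3)[OF v] G(13) by (simp add: F_ops)
    ultimately show "?h (cmp ?F p q) = cmp (G v) (?h p) (?h q)"
      using total_cmp[OF mor_vertex(4)[OF v]] vv by (simp add: F_ops)
  qed (use F vv G mor_vertex(3)[OF v] in \<open>auto simp: F_ops\<close>)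
  moreover have "bij_betw ?h (arr ?F) (arr (G v))"
    by (rule bij_betw_byWitness[where f' = "\<lambda>a. (v, a, src (G v) a)"]) (auto simp: F)
  ultimately show ?thesis by (simp add: graph_iso_def)
qed

text \<open>Computed in the total graph, the products x b and b' x' both have the normal form
  \<open>(\<gamma>, b', x')\<close>. So the factorisation defining the induced \<open>phi\<close> is
  the one prescribed by the given \<open>phi\<close>.\<close>

lemma total_phi:
  assumes \<gamma>: "\<gamma> \<in> arr \<Gamma>" and x: "x \<in> elts (M \<gamma>)" and b: "b \<in> arr (G (src \<Gamma> \<gamma>))"
    "msrc (M \<gamma>) x = rng (G (src \<Gamma> \<gamma>)) b"
    and phi: "phi (M \<gamma>) (x, b) = (b', x')"
  shows "phi (bundle_morph k \<Gamma> T fst \<gamma>)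
      ((\<gamma>, mrng (M \<gamma>) x, x), (src \<Gamma> \<gamma>, b, src (G (src \<Gamma> \<gamma>)) b)) =
    ((rng \<Gamma> \<gamma>, b', src (G (rng \<Gamma> \<gamma>)) b'), (\<gamma>, mrng (M \<gamma>) x', x'))"
proof (rule total.bundle_phi)
  have p: "b' \<in> arr (G (rng \<Gamma> \<gamma>))" "x' \<in> elts (M \<gamma>)" "src (G (rng \<Gamma> \<gamma>)) b' = mrng (M \<gamma>) x'"
    "src (G (src \<Gamma> \<gamma>)) b = msrc (M \<gamma>) x'" "rng (G (rng \<Gamma> \<gamma>)) b' = mrng (M \<gamma>) x"
    using k_morph_phi[OF mor[OF \<gamma>] x b] phi by (metis Pair_inject)+
  note g = k_graph_arr[OF base \<gamma>]
  note r = vertex_arr[OF grph_ends(1)[OF \<gamma>] mor_elts(1)[OF \<gamma> p(2)]]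
  note G = k_graph_arr[OF grph_ends(1)[OF \<gamma>] p(1)]
  show "(rng \<Gamma> \<gamma>, b', src (G (rng \<Gamma> \<gamma>)) b') \<in> arr T"
    using total_fibre_arr[OF g(12)] p(1) by blast
  show "fst (rng \<Gamma> \<gamma>, b', src (G (rng \<Gamma> \<gamma>)) b') = rng \<Gamma> \<gamma>" by simp
  show "(\<gamma>, mrng (M \<gamma>) x', x') \<in> total.E \<gamma>" using total_elts[OF \<gamma>] p(2) by blast
  show "src T (rng \<Gamma> \<gamma>, b', src (G (rng \<Gamma> \<gamma>)) b') = rng T (\<gamma>, mrng (M \<gamma>) x', x')"
    using g r p(3) mor_vertex(3)[OF g(12) G(13)] by simp
  have "cmp T (\<gamma>, mrng (M \<gamma>) x, x) (src \<Gamma> \<gamma>, b, src (G (src \<Gamma> \<gamma>)) b) = (\<gamma>, b', x')"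
    using total_cmp[OF phi] g(8) G(7) theta_unit(2)[OF \<gamma> p(2)] p(4,5) by simp
  moreover have "phi (M (rng \<Gamma> \<gamma>)) (src (G (rng \<Gamma> \<gamma>)) b', mrng (M \<gamma>) x') = (mrng (M \<gamma>) x', mrng (M \<gamma>) x')"
    using mor_vertex(4)[OF g(12) r(1)] r p(3) by simp
  then have "cmp T (rng \<Gamma> \<gamma>, b', src (G (rng \<Gamma> \<gamma>)) b') (\<gamma>, mrng (M \<gamma>) x', x') = (\<gamma>, b', x')"
    using total_cmp g(3,7) G(8) p(3) theta_unit(1)[OF \<gamma> p(2)] by simp
  ultimately show "cmp T (\<gamma>, mrng (M \<gamma>) x, x) (src \<Gamma> \<gamma>, b, src (G (src \<Gamma> \<gamma>)) b) =
      cmp T (rng \<Gamma> \<gamma>, b', src (G (rng \<Gamma> \<gamma>)) b') (\<gamma>, mrng (M \<gamma>) x', x')" by simp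
qed

lemma total_system_iso:
  "system_iso \<Gamma> (system_of k \<Gamma> T fst) X (\<lambda>v p. fst (snd p)) (\<lambda>\<gamma> p. snd (snd p))"
proof -
  let ?S = "system_of k \<Gamma> T fst"
    and ?hv = "\<lambda>(v :: 'g) (p :: 'g \<times> 'a \<times> 'a). fst (snd p)"
    and ?h = "\<lambda>(\<gamma> :: 'g) (p :: 'g \<times> 'a \<times> 'a). snd (snd p)"
  have S: "grph ?S = bundle_fibre k T fst" "mor ?S = bundle_morph k \<Gamma> T fst"
    "theta ?S = (\<lambda>\<alpha> \<beta> (x, y). cmp T x y)" by (simp_all add: system_of_def)
  have B: "elts (bundle_morph k \<Gamma> T fst \<gamma>) = total.E \<gamma>" "mrng (bundle_morph k \<Gamma> T fst \<gamma>) = rng T"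
    "msrc (bundle_morph k \<Gamma> T fst \<gamma>) = src T" for \<gamma> by (simp_all add: bundle_morph_def)
  have "bij_betw (?h \<gamma>) (total.E \<gamma>) (elts (M \<gamma>))" if "\<gamma> \<in> arr \<Gamma>" for \<gamma>
    by (rule bij_betw_byWitness[where f' = "\<lambda>x. (\<gamma>, mrng (M \<gamma>) x, x)"])
      (auto simp: total_elts[OF that])
  moreover have "msrc (M \<gamma>) (?h \<gamma> p) = ?hv (src \<Gamma> \<gamma>) (src T p) \<and>
      mrng (M \<gamma>) (?h \<gamma> p) = ?hv (rng \<Gamma> \<gamma>) (rng T p)" if "\<gamma> \<in> arr \<Gamma>" "p \<in> total.E \<gamma>" for \<gamma> p
    using that vertex_arr[OF grph_ends(1)[OF that(1)] mor_elts(1)[OF that(1)]]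
    by (auto simp: total_elts)
  moreover have "map_prod (?hv (rng \<Gamma> \<gamma>)) (?h \<gamma>) (phi (bundle_morph k \<Gamma> T fst \<gamma>) p) =
      phi (M \<gamma>) (map_prod (?h \<gamma>) (?hv (src \<Gamma> \<gamma>)) p)"
    if \<gamma>: "\<gamma> \<in> arr \<Gamma>"
      and p: "p \<in> fibre_right (bundle_morph k \<Gamma> T fst \<gamma>) (bundle_fibre k T fst (src \<Gamma> \<gamma>))" for \<gamma> p
  proof -
    note v = k_graph_arr(13)[OF base \<gamma>]
    obtain q t where qt: "p = (q, t)" "q \<in> total.E \<gamma>" "t \<in> arr T" "fst t = src \<Gamma> \<gamma>" "src T q = rng T t"
      using p by (auto simp: fibre_right_def B bundle_fibre_def)
    obtain x where x: "x \<in> elts (M \<gamma>)" "q = (\<gamma>, mrng (M \<gamma>) x, x)" using qt(2) total_elts[OF \<gamma>] by auto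
    obtain b where b: "b \<in> arr (G (src \<Gamma> \<gamma>))" "t = (src \<Gamma> \<gamma>, b, src (G (src \<Gamma> \<gamma>)) b)"
      using qt(3,4) total_fibre_arr[OF v] by blast
    have "msrc (M \<gamma>) x = rng (G (src \<Gamma> \<gamma>)) b" using qt(5) x b vertex_arr[OF base v] by simp
    moreover obtain b' x' where "phi (M \<gamma>) (x, b) = (b', x')" by fastforce
    ultimately show ?thesis using total_phi[OF \<gamma> x(1) b(1)] qt(1) x(2) b(2) by simp
  qed
  moreover have "?h (cmp \<Gamma> \<alpha> \<beta>) (cmp T p q) = theta X \<alpha> \<beta> (?h \<alpha> p, ?h \<beta> q)"
    if \<alpha>: "\<alpha> \<in> arr \<Gamma>" "\<beta> \<in> arr \<Gamma>" "src \<Gamma> \<alpha> = rng \<Gamma> \<beta>" and pq: "p \<in> total.E \<alpha>" "q \<in> total.E \<beta>"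
      "src T p = rng T q" for \<alpha> \<beta> p q
  proof -
    obtain x where x: "x \<in> elts (M \<alpha>)" "p = (\<alpha>, mrng (M \<alpha>) x, x)" using pq total_elts[OF \<alpha>(1)] by auto
    obtain y where y: "y \<in> elts (M \<beta>)" "q = (\<beta>, mrng (M \<beta>) y, y)" using pq total_elts[OF \<alpha>(2)] by auto
    have "msrc (M \<alpha>) x = mrng (M \<beta>) y"
      using pq(3) x y vertex_arr[OF grph_ends(1)[OF \<alpha>(2)] mor_elts(1)[OF \<alpha>(2) y(1)]] by simp
    \<comment> \<open>The graph entry of \<open>q\<close> is the vertex r(y) = s(x), so moving it
      past \<open>x\<close> leaves \<open>x\<close> unchanged and the third entry of the product is
      exactly the \<open>theta\<close> of \<open>x\<close> and \<open>y\<close>.\<close>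
    then show ?thesis
      using total_cmp[OF k_morph_phi_vertex[OF grph_ends[OF \<alpha>(1)] mor[OF \<alpha>(1)] x(1)]] x(2) y(2) by simp
  qed
  ultimately show ?thesis
    unfolding system_iso_def S B using total_fibre_iso by (auto simp: comp_morph_def B)
qed

theorem total_bundle: "gamma_bundle k l \<Gamma> X T fst"
  unfolding gamma_bundle_def system_isomorphic_def
proof (intro conjI exI)
  show "fst ` vertices T = vertices \<Gamma>"
  proof (intro equalityI subsetI)
    fix v assume "v \<in> fst ` vertices T"
    then obtain p where "p \<in> arr T" "deg T p = 0" "v = fst p" unfolding vertices_def by blast
    then show "v \<in> vertices \<Gamma>" using total.proj_arr[of p] by (simp add: vertices_def)
  next
    fix v assume v: "v \<in> vertices \<Gamma>"
    \<comment> \<open>Surjectivity on vertices rests on each graph of the system being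
      nonempty.\<close>
    obtain w where "w \<in> vertices (G v)" using vertices_nonempty[OF grph[OF v]] .
    then have "(v, w, w) \<in> vertices T" using total_vertex[OF v] by (simp add: vertices_def)
    then show "v \<in> fst ` vertices T" by force
  qed
qed (use total_k_graph total_proj total_system_iso in auto)

end


section \<open>Every bundle is isomorphic to the total graph\<close>

text \<open>The isomorphism of systems is fixed as data because the comparison map is assembled from
  it: \<open>h0\<close> treats the factor \<open>a\<close> of a product ax, and \<open>h\<close> the
  factor \<open>x\<close>.\<close>

locale system_bundle = graph_system k l \<Gamma> X + bun: graph_over k l \<Gamma> \<Sigma> f
  for k l :: nat and \<Gamma> :: "'g graph_data" and X :: "('g, 'a) system_data"
    and \<Sigma> :: "'s graph_data" and f :: "'s \<Rightarrow> 'g" +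
  fixes h0 h :: "'g \<Rightarrow> 's \<Rightarrow> 'a"
  assumes iso: "system_iso \<Gamma> (system_of k \<Gamma> \<Sigma> f) X h0 h"
begin

section \<open>The given isomorphism of systems in elementwise form\<close>

lemma h0_iso:
  "v \<in> vertices \<Gamma> \<Longrightarrow> graph_iso (bundle_fibre k \<Sigma> f v) (G v) (h0 v)"
  using iso by (simp add: system_iso_def system_of_def)

lemma h0_arr:
  assumes "v \<in> vertices \<Gamma>" "a \<in> arr \<Sigma>" "f a = v"
  shows "h0 v a \<in> arr (G v)" "rng (G v) (h0 v a) = h0 v (rng \<Sigma> a)"
    "src (G v) (h0 v a) = h0 v (src \<Sigma> a)" "deg (G v) (h0 v a) = first_coords k (deg \<Sigma> a)"
  using h0_iso[OF assms(1)] assms(2,3) by (auto simp: graph_iso_def quasimorphism_def bundle_fibre_def)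

lemma h0_cmp:
  assumes "v \<in> vertices \<Gamma>" "a \<in> arr \<Sigma>" "f a = v" "b \<in> arr \<Sigma>" "f b = v" "src \<Sigma> a = rng \<Sigma> b"
  shows "h0 v (cmp \<Sigma> a b) = cmp (G v) (h0 v a) (h0 v b)"
  using h0_iso[OF assms(1)] assms(2-) by (auto simp: graph_iso_def quasimorphism_def bundle_fibre_def)

lemma h0_inj:
  assumes "v \<in> vertices \<Gamma>" "a \<in> arr \<Sigma>" "f a = v" "b \<in> arr \<Sigma>" "f b = v" "h0 v a = h0 v b"
  shows "a = b"
  using h0_iso[OF assms(1)] assms(2-)
  by (auto simp: graph_iso_def bij_betw_def bundle_fibre_def dest: inj_onD)

lemma h0_surj:
  assumes "v \<in> vertices \<Gamma>" "b \<in> arr (G v)"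
  obtains a where "a \<in> arr \<Sigma>" "f a = v" "b = h0 v a"
  using h0_iso[OF assms(1)] assms(2) that
  by (auto simp: graph_iso_def bij_betw_def bundle_fibre_def)

lemma h_bij: "\<gamma> \<in> arr \<Gamma> \<Longrightarrow> bij_betw (h \<gamma>) (bun.E \<gamma>) (elts (M \<gamma>))"
  using iso by (simp add: system_iso_def system_of_def bundle_morph_def)

lemma h_elts:
  assumes "\<gamma> \<in> arr \<Gamma>" "x \<in> bun.E \<gamma>"
  shows "h \<gamma> x \<in> elts (M \<gamma>)" "msrc (M \<gamma>) (h \<gamma> x) = h0 (src \<Gamma> \<gamma>) (src \<Sigma> x)"
    "mrng (M \<gamma>) (h \<gamma> x) = h0 (rng \<Gamma> \<gamma>) (rng \<Sigma> x)"
proof -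
  show "h \<gamma> x \<in> elts (M \<gamma>)" using bij_betwE[OF h_bij] assms by blast
  show "msrc (M \<gamma>) (h \<gamma> x) = h0 (src \<Gamma> \<gamma>) (src \<Sigma> x)"
    "mrng (M \<gamma>) (h \<gamma> x) = h0 (rng \<Gamma> \<gamma>) (rng \<Sigma> x)"
    using iso[unfolded system_iso_def, THEN conjunct2, THEN conjunct1, THEN bspec, OF assms(1)] assms(2)
    by (simp_all add: system_of_def bundle_morph_def)
qed

lemma h_inj:
  assumes "\<gamma> \<in> arr \<Gamma>" "x \<in> bun.E \<gamma>" "y \<in> bun.E \<gamma>" "h \<gamma> x = h \<gamma> y"
  shows "x = y"
  using h_bij[OF assms(1)] assms(2-) by (auto simp: bij_betw_def dest: inj_onD)

lemma h_surj:
  assumes "\<gamma> \<in> arr \<Gamma>" "y \<in> elts (M \<gamma>)"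
  obtains x where "x \<in> bun.E \<gamma>" "y = h \<gamma> x"
  using h_bij[OF assms(1)] assms(2) that unfolding bij_betw_def by blast

text \<open>Stated for an explicit factorisation xa = by, so that the definite description behind
  the induced \<open>phi\<close> does not reappear in later computations.\<close>

lemma h_phi:
  assumes \<gamma>: "\<gamma> \<in> arr \<Gamma>" and x: "x \<in> bun.E \<gamma>" and a: "a \<in> arr \<Sigma>" "f a = src \<Gamma> \<gamma>" "src \<Sigma> x = rng \<Sigma> a"
    and b: "b \<in> arr \<Sigma>" "f b = rng \<Gamma> \<gamma>" "y \<in> bun.E \<gamma>" "src \<Sigma> b = rng \<Sigma> y" "cmp \<Sigma> x a = cmp \<Sigma> b y"
  shows "phi (M \<gamma>) (h \<gamma> x, h0 (src \<Gamma> \<gamma>) a) = (h0 (rng \<Gamma> \<gamma>) b, h \<gamma> y)"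
proof -
  have "(x, a) \<in> fibre_right (bundle_morph k \<Gamma> \<Sigma> f \<gamma>) (bundle_fibre k \<Sigma> f (src \<Gamma> \<gamma>))"
    using x a by (simp add: fibre_right_def bundle_morph_def bundle_fibre_def)
  then have "map_prod (h0 (rng \<Gamma> \<gamma>)) (h \<gamma>) (phi (bundle_morph k \<Gamma> \<Sigma> f \<gamma>) (x, a)) =
      phi (M \<gamma>) (map_prod (h \<gamma>) (h0 (src \<Gamma> \<gamma>)) (x, a))"
    using iso[unfolded system_iso_def] \<gamma> by (simp add: system_of_def)
  then show ?thesis using bun.bundle_phi[OF b] by simp
qed

lemma h_theta:
  assumes "\<alpha> \<in> arr \<Gamma>" "\<beta> \<in> arr \<Gamma>" "src \<Gamma> \<alpha> = rng \<Gamma> \<beta>" "x \<in> bun.E \<alpha>" "y \<in> bun.E \<beta>" "src \<Sigma> x = rng \<Sigma> y"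
  shows "h (cmp \<Gamma> \<alpha> \<beta>) (cmp \<Sigma> x y) = theta X \<alpha> \<beta> (h \<alpha> x, h \<beta> y)"
proof -
  have "(x, y) \<in> elts (comp_morph (bundle_morph k \<Gamma> \<Sigma> f \<alpha>) (bundle_morph k \<Gamma> \<Sigma> f \<beta>))"
    using assms by (simp add: comp_morph_def bundle_morph_def)
  then show ?thesis
    using iso[unfolded system_iso_def] assms(1-3) by (fastforce simp: system_of_def)
qed

lemma vertex_elts:
  assumes "w \<in> vertices \<Sigma>"
  shows "f w \<in> vertices \<Gamma>" "w \<in> bun.E (f w)"
  using assms bun.proj_arr[of w] by (auto simp: vertices_def bundle_elts_def)

text \<open>Forced by compatibility with ranges: on the identity morph the range map is the
  identity, so the range of the image of \<open>w\<close> under \<open>h\<close> is that image, and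
  it is also the image of \<open>w\<close> under \<open>h0\<close>.\<close>

lemma h_vertex:
  assumes w: "w \<in> vertices \<Sigma>"
  shows "h (f w) w = h0 (f w) w"
proof -
  note v = vertex_elts[OF w] and vv = vertex_arr[OF base vertex_elts(1)[OF w]]
  have "mrng (M (f w)) (h (f w) w) = h0 (f w) w"
    using h_elts(3)[OF vv(1) v(2)] vv vertex_arr[OF bun.tot w] by simp
  moreover have "mrng (M (f w)) (h (f w) w) = h (f w) w"
    using h_elts(1)[OF vv(1) v(2)] mor_vertex[OF v(1)] by simp
  ultimately show ?thesis by simp
qed

text \<open>The choice is made over the resulting triple, with the splitting
  \<open>\<sigma> = ax\<close> under an existential quantifier. Splittings exist and are unique, so
  the triple is determined.\<close>

definition to_total :: "'s \<Rightarrow> 'g \<times> 'a \<times> 'a" where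
  "to_total \<sigma> = (SOME p. \<exists>a x. a \<in> arr \<Sigma> \<and> f a = rng \<Gamma> (f \<sigma>) \<and> x \<in> bun.E (f \<sigma>) \<and>
     src \<Sigma> a = rng \<Sigma> x \<and> \<sigma> = cmp \<Sigma> a x \<and> p = (f \<sigma>, h0 (rng \<Gamma> (f \<sigma>)) a, h (f \<sigma>) x))"

lemma to_total_cmp:
  assumes "a \<in> arr \<Sigma>" "f a = rng \<Gamma> \<gamma>" "x \<in> bun.E \<gamma>" "src \<Sigma> a = rng \<Sigma> x"
  shows "to_total (cmp \<Sigma> a x) = (\<gamma>, h0 (rng \<Gamma> \<gamma>) a, h \<gamma> x)"
  unfolding to_total_def bun.proj_cmp_fibre[OF assms(1,3,4,2)]
proof (rule some_equality)
  show "\<exists>a' x'. a' \<in> arr \<Sigma> \<and> f a' = rng \<Gamma> \<gamma> \<and> x' \<in> bun.E \<gamma> \<and> src \<Sigma> a' = rng \<Sigma> x' \<and>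
      cmp \<Sigma> a x = cmp \<Sigma> a' x' \<and> (\<gamma>, h0 (rng \<Gamma> \<gamma>) a, h \<gamma> x) = (\<gamma>, h0 (rng \<Gamma> \<gamma>) a', h \<gamma> x')"
    using assms by blast
qed (use assms bun.split_unique in blast)

text \<open>A vertex splits as w = ww, with one copy sent by \<open>h0\<close> and the other by
  \<open>h\<close>; by \<open>h_vertex\<close> both images coincide, which matches the shape of an
  identity in the total graph.\<close>

lemma to_total_vertex:
  assumes w: "w \<in> vertices \<Sigma>"
  shows "to_total w = (f w, h0 (f w) w, h0 (f w) w)"
proof -
  note v = vertex_elts[OF w] and vv = vertex_arr[OF base vertex_elts(1)[OF w]]
    and ww = vertex_arr[OF bun.tot w]
  have "cmp \<Sigma> w w = w" using k_graph_arr(7)[OF bun.tot ww(1)] ww(2) by simp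
  then show ?thesis using to_total_cmp[OF ww(1) _ v(2)] ww vv h_vertex[OF w] by simp
qed

lemma to_total_quasimorphism: "quasimorphism id \<Sigma> T to_total"
proof -
  have 1: "to_total \<sigma> \<in> arr T \<and> to_total (rng \<Sigma> \<sigma>) = rng T (to_total \<sigma>) \<and>
      to_total (src \<Sigma> \<sigma>) = src T (to_total \<sigma>) \<and> deg T (to_total \<sigma>) = deg \<Sigma> \<sigma>"
    if \<sigma>: "\<sigma> \<in> arr \<Sigma>" for \<sigma>
  proof -
    define \<gamma> where "\<gamma> = f \<sigma>"
    obtain a x where a: "a \<in> arr \<Sigma>" "f a = rng \<Gamma> \<gamma>" "x \<in> bun.E \<gamma>" "src \<Sigma> a = rng \<Sigma> x"
      and ax: "\<sigma> = cmp \<Sigma> a x" using bun.split_ex[OF \<sigma>] unfolding \<gamma>_def by metis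
    have \<gamma>: "\<gamma> \<in> arr \<Gamma>" using bun.proj_arr(1)[OF \<sigma>] by (simp add: \<gamma>_def)
    note v = k_graph_arr(12)[OF base \<gamma>]
    note xa = bun.elts_arr[OF a(3)]
    note c = k_graph_cmp[OF bun.tot a(1) xa(1) a(4), folded ax]
    note t = to_total_cmp[OF a, folded ax]
    have "to_total \<sigma> \<in> arr T"
      using t \<gamma> h0_arr[OF v a(1,2)] h_elts[OF \<gamma> a(3)] a(4) by simp
    moreover have "to_total (rng \<Sigma> \<sigma>) = rng T (to_total \<sigma>)"
      using to_total_vertex[OF k_graph_arr(12)[OF bun.tot \<sigma>]] t bun.proj_arr(2)[OF \<sigma>] c(2)
        h0_arr(2)[OF v a(1,2)] by (simp add: \<gamma>_def)
    moreover have "to_total (src \<Sigma> \<sigma>) = src T (to_total \<sigma>)"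
      using to_total_vertex[OF k_graph_arr(13)[OF bun.tot \<sigma>]] t bun.proj_arr(3)[OF \<sigma>] c(3)
        h_elts(2)[OF \<gamma> a(3)] by (simp add: \<gamma>_def)
    \<comment> \<open>The total graph records only the first coordinates of the degree of
      \<open>a\<close>. Nothing is lost, since \<open>a\<close> lies over a vertex and has degree
      (m, 0).\<close>
    moreover have "last_coords k (deg \<Sigma> a) = 0"
      using bun.proj_arr(4)[OF a(1)] a(2) vertex_arr(4)[OF base v] by simp
    then have "deg \<Sigma> a = join_coords k (first_coords k (deg \<Sigma> a)) 0"
      using join_coords_first_last[of k "deg \<Sigma> a"] by simp
    then have "deg \<Sigma> \<sigma> = join_coords k (first_coords k (deg \<Sigma> a)) (deg \<Gamma> \<gamma>)"
      using c(4) a(3) join_coords_add[of k "first_coords k (deg \<Sigma> a)" 0 0 "deg \<Gamma> \<gamma>"]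
      by (simp add: bundle_elts_def)
    then have "deg T (to_total \<sigma>) = deg \<Sigma> \<sigma>" using t h0_arr(4)[OF v a(1,2)] by simp
    ultimately show ?thesis by simp
  qed
  have 2: "to_total (cmp \<Sigma> \<sigma> \<tau>) = cmp T (to_total \<sigma>) (to_total \<tau>)"
    if \<sigma>: "\<sigma> \<in> arr \<Sigma>" "\<tau> \<in> arr \<Sigma>" "src \<Sigma> \<sigma> = rng \<Sigma> \<tau>" for \<sigma> \<tau>
  proof -
    define \<gamma> \<delta> where "\<gamma> = f \<sigma>" and "\<delta> = f \<tau>"
    have \<gamma>: "\<gamma> \<in> arr \<Gamma>" "\<delta> \<in> arr \<Gamma>" "src \<Gamma> \<gamma> = rng \<Gamma> \<delta>"
      using bun.proj_arr[OF \<sigma>(1)] bun.proj_arr[OF \<sigma>(2)] \<sigma>(3) by (simp_all add: \<gamma>_def \<delta>_def)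
    obtain a x where a: "a \<in> arr \<Sigma>" "f a = rng \<Gamma> \<gamma>" "x \<in> bun.E \<gamma>" "src \<Sigma> a = rng \<Sigma> x"
      and ax: "\<sigma> = cmp \<Sigma> a x" using bun.split_ex[OF \<sigma>(1)] unfolding \<gamma>_def by metis
    obtain b y where b: "b \<in> arr \<Sigma>" "f b = rng \<Gamma> \<delta>" "y \<in> bun.E \<delta>" "src \<Sigma> b = rng \<Sigma> y"
      and bsplit: "\<tau> = cmp \<Sigma> b y" using bun.split_ex[OF \<sigma>(2)] unfolding \<delta>_def by metis
    note x = bun.elts_arr[OF a(3)] and y = bun.elts_arr[OF b(3)]
    note c = k_graph_cmp[OF bun.tot] and as = k_graph_assoc[OF bun.tot]
    have xb: "src \<Sigma> x = rng \<Sigma> b"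
      using \<sigma>(3) c(3)[OF a(1) x(1) a(4)] c(2)[OF b(1) y(1) b(4)] by (simp add: ax bsplit)
    obtain b' x' where b': "b' \<in> arr \<Sigma>" "f b' = rng \<Gamma> \<gamma>" "x' \<in> bun.E \<gamma>" "src \<Sigma> b' = rng \<Sigma> x'"
      and xb': "cmp \<Sigma> x b = cmp \<Sigma> b' x'"
      using bun.bundle_phi_ex[OF a(3) b(1) _ xb] b(2) \<gamma>(3) by metis
    note x' = bun.elts_arr[OF b'(3)]
    note v = k_graph_arr(12)[OF base \<gamma>(1)]
    note vv = vertex_arr[OF base v]
    have ab': "src \<Sigma> a = rng \<Sigma> b'"
      using c(2)[OF x(1) b(1) xb] c(2)[OF b'(1) x'(1) b'(4)] xb' a(4) by simp
    have xy: "src \<Sigma> x' = rng \<Sigma> y"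
      using c(3)[OF x(1) b(1) xb] c(3)[OF b'(1) x'(1) b'(4)] xb' b(4) by simp
    note cx = c[OF x'(1) y(1) xy] and ca = c[OF a(1) b'(1) ab']
    \<comment> \<open>This makes (ab')(x'y) a splitting of the composite over
      \<open>\<gamma>\<delta>\<close>, so that \<open>to_total_cmp\<close> can evaluate the map
      there.\<close>
    have E: "cmp \<Sigma> x' y \<in> bun.E (cmp \<Gamma> \<gamma> \<delta>)"
      using cx bun.proj_cmp[OF x'(1) y(1) xy] b'(3) b(3) k_graph_cmp(4)[OF base \<gamma>]
      by (simp add: bundle_elts_def join_coords_add)
    have "cmp \<Sigma> \<sigma> \<tau> = cmp \<Sigma> a (cmp \<Sigma> x (cmp \<Sigma> b y))"
      using as[OF a(1) x(1) c(1)[OF b(1) y(1) b(4)] a(4)] xb c(2)[OF b(1) y(1) b(4)]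
      by (simp add: ax bsplit)
    also have "\<dots> = cmp \<Sigma> a (cmp \<Sigma> b' (cmp \<Sigma> x' y))"
      using as[OF x(1) b(1) y(1) xb b(4)] as[OF b'(1) x'(1) y(1) b'(4) xy] xb' by simp
    also have "\<dots> = cmp \<Sigma> (cmp \<Sigma> a b') (cmp \<Sigma> x' y)"
      using as[OF a(1) b'(1) cx(1) ab'] b'(4) cx(2) by simp
    finally have "cmp \<Sigma> \<sigma> \<tau> = cmp \<Sigma> (cmp \<Sigma> a b') (cmp \<Sigma> x' y)" .
    moreover have "f (cmp \<Sigma> a b') = rng \<Gamma> (cmp \<Gamma> \<gamma> \<delta>)"
      using bun.proj_cmp[OF a(1) b'(1) ab'] a(2) b'(2) k_graph_arr(7)[OF base vv(1)] vv(2)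
        k_graph_cmp(2)[OF base \<gamma>] by simp
    ultimately have "to_total (cmp \<Sigma> \<sigma> \<tau>) =
        (cmp \<Gamma> \<gamma> \<delta>, h0 (rng \<Gamma> \<gamma>) (cmp \<Sigma> a b'), h (cmp \<Gamma> \<gamma> \<delta>) (cmp \<Sigma> x' y))"
      using to_total_cmp[OF ca(1) _ E] ca(3) cx(2) b'(4) k_graph_cmp(2)[OF base \<gamma>] by simp
    \<comment> \<open>The graph entry uses that \<open>h0\<close> is a functor, the morph entry that
      \<open>h\<close> respects \<open>theta\<close>. The remaining step, through
      \<open>h_phi\<close>, recognises the images of b' and x' as the pair that \<open>phi\<close>
      produces from the images of \<open>x\<close> and \<open>b\<close>.\<close>
    also have "\<dots> = (cmp \<Gamma> \<gamma> \<delta>, cmp (G (rng \<Gamma> \<gamma>)) (h0 (rng \<Gamma> \<gamma>) a) (h0 (rng \<Gamma> \<gamma>) b'),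
        theta X \<gamma> \<delta> (h \<gamma> x', h \<delta> y))"
      using h0_cmp[OF v a(1,2) b'(1,2) ab'] h_theta[OF \<gamma> b'(3) b(3) xy] by simp
    also have "\<dots> = cmp T (to_total \<sigma>) (to_total \<tau>)"
      using total_cmp[OF h_phi[OF \<gamma>(1) a(3) b(1) _ xb b' xb']] b(2) \<gamma>(3)
        to_total_cmp[OF a] to_total_cmp[OF b] by (simp add: ax bsplit)
    finally show ?thesis .
  qed
  show ?thesis unfolding quasimorphism_def using 1 2 bun.tot by simp
qed

lemma to_total_fst: "\<sigma> \<in> arr \<Sigma> \<Longrightarrow> fst (to_total \<sigma>) = f \<sigma>"
  using bun.split_ex[of \<sigma>] to_total_cmp by (metis fst_conv)

lemma to_total_bij: "bij_betw to_total (arr \<Sigma>) (arr T)"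
proof (rule bij_betw_imageI)
  show "inj_on to_total (arr \<Sigma>)"
  proof (rule inj_onI)
    fix \<sigma> \<tau> assume \<sigma>: "\<sigma> \<in> arr \<Sigma>" "\<tau> \<in> arr \<Sigma>" and eq: "to_total \<sigma> = to_total \<tau>"
    define \<gamma> where "\<gamma> = f \<sigma>"
    \<comment> \<open>The tag in the triple shows that both arrows lie over the same
      \<open>\<gamma>\<close>, so one injective pair of maps, \<open>h0\<close> at r(\<gamma>) and
      \<open>h\<close> at \<open>\<gamma>\<close>, applies to both splittings.\<close>
    have \<tau>: "f \<tau> = \<gamma>" using to_total_fst[OF \<sigma>(1)] to_total_fst[OF \<sigma>(2)] eq by (simp add: \<gamma>_def)
    have \<gamma>: "\<gamma> \<in> arr \<Gamma>" using bun.proj_arr(1)[OF \<sigma>(1)] by (simp add: \<gamma>_def)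
    obtain a x where a: "a \<in> arr \<Sigma>" "f a = rng \<Gamma> \<gamma>" "x \<in> bun.E \<gamma>" "src \<Sigma> a = rng \<Sigma> x"
      and ax: "\<sigma> = cmp \<Sigma> a x" using bun.split_ex[OF \<sigma>(1)] unfolding \<gamma>_def by metis
    obtain b y where b: "b \<in> arr \<Sigma>" "f b = rng \<Gamma> \<gamma>" "y \<in> bun.E \<gamma>" "src \<Sigma> b = rng \<Sigma> y"
      and bsplit: "\<tau> = cmp \<Sigma> b y" using bun.split_ex[OF \<sigma>(2)] unfolding \<tau> by metis
    have "h0 (rng \<Gamma> \<gamma>) a = h0 (rng \<Gamma> \<gamma>) b" "h \<gamma> x = h \<gamma> y"
      using to_total_cmp[OF a] to_total_cmp[OF b] eq ax bsplit by auto
    then have "a = b" "x = y"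
      using h0_inj[OF k_graph_arr(12)[OF base \<gamma>] a(1,2) b(1,2)] h_inj[OF \<gamma> a(3) b(3)] by auto
    then show "\<sigma> = \<tau>" using ax bsplit by simp
  qed
  have "p \<in> to_total ` arr \<Sigma>" if "p \<in> arr T" for p
  proof -
    obtain \<gamma> b y where p: "p = (\<gamma>, b, y)" by (metis prod_cases3)
    have \<gamma>: "\<gamma> \<in> arr \<Gamma>" and b: "b \<in> arr (G (rng \<Gamma> \<gamma>))" and y: "y \<in> elts (M \<gamma>)"
      and eq: "src (G (rng \<Gamma> \<gamma>)) b = mrng (M \<gamma>) y" using that p by auto
    note v = k_graph_arr(12)[OF base \<gamma>]
    note vv = vertex_arr[OF base v]
    obtain a where a: "a \<in> arr \<Sigma>" "f a = rng \<Gamma> \<gamma>" "b = h0 (rng \<Gamma> \<gamma>) a" using h0_surj[OF v b] .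
    obtain x where x: "x \<in> bun.E \<gamma>" "y = h \<gamma> x" using h_surj[OF \<gamma> y] .
    note xa = bun.elts_arr[OF x(1)]
    \<comment> \<open>The preimages \<open>a\<close> and \<open>x\<close> are chosen independently,
      so their composability has to be recovered. Both \<open>src a\<close> and \<open>rng x\<close>
      lie over r(\<gamma>), where \<open>h0\<close> is injective.\<close>
    have "h0 (rng \<Gamma> \<gamma>) (src \<Sigma> a) = h0 (rng \<Gamma> \<gamma>) (rng \<Sigma> x)"
      using eq h0_arr(3)[OF v a(1,2)] h_elts(3)[OF \<gamma> x(1)] a(3) x(2) by simp
    then have s: "src \<Sigma> a = rng \<Sigma> x"
      using h0_inj[OF v] k_graph_arr[OF bun.tot a(1)] k_graph_arr[OF bun.tot xa(1)]
        bun.proj_arr[OF a(1)] bun.proj_arr[OF xa(1)] a(2) xa(2) vv by simp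
    show ?thesis
      using to_total_cmp[OF a(1,2) x(1) s] k_graph_cmp(1)[OF bun.tot a(1) xa(1) s] a(3) x(2) p
      by (metis image_eqI)
  qed
  then show "to_total ` arr \<Sigma> = arr T"
    using to_total_quasimorphism by (auto simp: quasimorphism_def)
qed

end

lemma gamma_bundle_iso_total:
  assumes "k_graph l \<Gamma>" "gamma_system k \<Gamma> X" "gamma_bundle k l \<Gamma> X \<Sigma> f"
  shows "\<exists>h. graph_iso \<Sigma> (total_graph k \<Gamma> X) h \<and> (\<forall>x\<in>arr \<Sigma>. fst (h x) = f x)"
proof -
  obtain h0 h where "system_iso \<Gamma> (system_of k \<Gamma> \<Sigma> f) X h0 h"
    using assms(3) by (auto simp: gamma_bundle_def system_isomorphic_def)
  then interpret system_bundle k l \<Gamma> X \<Sigma> f h0 h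
    by unfold_locales (use assms in \<open>auto simp: gamma_bundle_def\<close>)
  show ?thesis
    using to_total_quasimorphism to_total_bij to_total_fst unfolding graph_iso_def by blast
qed

theorem theorem5p9:
  fixes k l :: nat
    and \<Gamma> :: "'g graph_data"
    and X :: "('g, 'a) system_data"
  assumes "k_graph l \<Gamma>"
    and "gamma_system k \<Gamma> X"
  shows "(\<exists>(\<Sigma> :: ('g \<times> 'a \<times> 'a) graph_data) f. gamma_bundle k l \<Gamma> X \<Sigma> f) \<and>
         (\<forall>(\<Sigma> :: 'b graph_data) f (\<Psi> :: 'c graph_data) g.
            gamma_bundle k l \<Gamma> X \<Sigma> f \<and> gamma_bundle k l \<Gamma> X \<Psi> g \<longrightarrow>
            (\<exists>h. graph_iso \<Sigma> \<Psi> h \<and> (\<forall>x\<in>arr \<Sigma>. g (h x) = f x)))"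
proof (intro conjI allI impI)
  interpret graph_system k l \<Gamma> X by unfold_locales (use assms in auto)
  show "\<exists>(\<Sigma> :: ('g \<times> 'a \<times> 'a) graph_data) f. gamma_bundle k l \<Gamma> X \<Sigma> f"
    using total_bundle by blast
  fix \<Sigma> :: "'b graph_data" and f and \<Psi> :: "'c graph_data" and g
  assume bundles: "gamma_bundle k l \<Gamma> X \<Sigma> f \<and> gamma_bundle k l \<Gamma> X \<Psi> g"
  \<comment> \<open>Both bundles are mapped to the total graph over the base; the required
    isomorphism is the first map followed by the inverse of the second.\<close>
  obtain h where h: "graph_iso \<Sigma> T h" "\<And>x. x \<in> arr \<Sigma> \<Longrightarrow> fst (h x) = f x"
    using gamma_bundle_iso_total[OF assms conjunct1[OF bundles]] by blast
  obtain h' where h': "graph_iso \<Psi> T h'" "\<And>y. y \<in> arr \<Psi> \<Longrightarrow> fst (h' y) = g y"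
    using gamma_bundle_iso_total[OF assms conjunct2[OF bundles]] by blast
  let ?i = "the_inv_into (arr \<Psi>) h'"
  have "small_category \<Psi>" using bundles by (simp add: gamma_bundle_def k_graph_def)
  from graph_iso_comp[OF h(1) graph_iso_inv[OF this h'(1)]]
  have "graph_iso \<Sigma> \<Psi> (?i \<circ> h)" .
  moreover have "g (?i (h x)) = f x" if x: "x \<in> arr \<Sigma>" for x
  proof -
    have "h x \<in> h' ` arr \<Psi>" "inj_on h' (arr \<Psi>)"
      using h(1) h'(1) x by (auto simp: graph_iso_def bij_betw_def)
    then have "h' (?i (h x)) = h x" "?i (h x) \<in> arr \<Psi>"
      by (auto simp: f_the_inv_into_f the_inv_into_into)
    then show ?thesis using h(2)[OF x] h'(2) by metis
  qed
  ultimately show "\<exists>h. graph_iso \<Sigma> \<Psi> h \<and> (\<forall>x\<in>arr \<Sigma>. g (h x) = f x)"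
    by (intro exI[of _ "?i \<circ> h"]) simp
qed

end
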